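(* Let $\{p_\theta:\theta\in\Theta\}$, $\Theta\subseteq\mathbb{R}$, be a family of probability densities such that for every $\theta\in\Theta$: the score $s(\theta,y)=\partial\log p_\theta(y)/\partial\theta$ exists and is finite, $E_\theta\{s(\theta,Y)\}=0$, $\mathcal{I}(\theta)=E_\theta\{s(\theta,Y)^2\}<\infty$, $\mathcal{I}(\cdot)$ is continuous at $\theta$, and $\mathcal{I}(\theta)>0$. Let $\theta^*\in\Theta$, and let $Y_1,Y_2,\dots$ be independent and identically distributed from $P^*$, where $P^*$ has density $p_{\theta^*}$. Suppose that $\theta\mapsto\mathcal{I}(\theta)^{-1}$ is continuously differentiable in a neighbourhood of $\theta^*$, and that there exist non-negative constants $B,C<\infty$ such that, with $Z(\theta,Y)=\mathcal{I}(\theta)^{-1}s(\theta,Y)$, $$E_\theta\{Z(\theta,Y)^4\}\le B+C\theta^4\quad\text{for all }\theta\in\Theta.$$ Suppose $\theta_n=\theta_n(Y_{1:n})\in\Theta$, $n\ge1$, is a sequence of estimators computed from $Y_{1:n}$ that is strongly consistent at $\theta^*$, i.e. $\theta_n\to\theta^*$ $P^*$-almost surely. For each $n$, given $Y_{1:n}$, let $\theta_{n\infty}$ be distributed according to the martingale posterior started at $\theta_n$ (defined in the context). Then, $P^*$-almost surely, $$r_n^{-1}(\theta_{n\infty}-\theta_n)\to\mathcal{N}\{0,\mathcal{I}(\theta^* )^{-1}\}\quad\text{in distribution as }n\to\infty,$$ where $r_n^2=\sum_{i=n+1}^\infty i^{-2}$; that is, for $P^*$-almost every data sequence $Y_{1:\infty}$,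 the conditional law of $r_n^{-1}(\theta_{n\infty}-\theta_n)$ given $Y_{1:n}$ converges weakly to $\mathcal{N}\{0,\mathcal{I}(\theta^* )^{-1}\}$.
   Context: The densities are on a space $\mathcal{Y}$ (with respect to a fixed dominating measure; all functions are understood to be measurable), and $E_\theta$ is expectation under $Y\sim p_\theta$. Martingale posterior: given $Y_{1:n}$, set $\theta_{n0}=\theta_n$ and for $i\ge1$ draw, conditionally on the past simulated values $\widetilde Y_{n1},\dots,\widetilde Y_{n,i-1}$ (and $Y_{1:n}$), $\widetilde Y_{ni}\sim p_{\theta_{n,i-1}}$ and put $$\theta_{ni}=\theta_{n,i-1}+(n+i)^{-1}\,\mathcal{I}(\theta_{n,i-1})^{-1}s(\theta_{n,i-1},\widetilde Y_{ni}).$$ It is understood that all iterates $\theta_{ni}$ lie in $\Theta$ almost surely. Under the hypotheses, given $Y_{1:n}$, $(\theta_{ni})_{i\ge0}$ is a martingale bounded in $L_2$, and $\theta_{n\infty}=\lim_{i\to\infty}\theta_{ni}$ is its almost sure limit; the conditional distribution of $\theta_{n\infty}$ given $Y_{1:n}$ is the martingale posterior. *)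

theory Defs
  imports "HOL-Probability.Probability"
begin

definition model :: "'y measure \<Rightarrow> (real \<Rightarrow> 'y \<Rightarrow> real) \<Rightarrow> real \<Rightarrow> 'y measure" where
  "model \<mu> p \<theta> = density \<mu> (\<lambda>y. ennreal (p \<theta> y))"

(* The log-likelihood t |-> ln (p t y), a function on \<Theta>, has derivative d at \<theta>.
   The limit-point condition makes the derivative relative to \<Theta> unique.  The positivity
   conditions are needed because ln 0 = 0 in HOL, whereas a vanishing density means
   log-likelihood minus infinity. *)
definition has_score ::
  "real set \<Rightarrow> (real \<Rightarrow> 'y \<Rightarrow> real) \<Rightarrow> real \<Rightarrow> 'y \<Rightarrow> real \<Rightarrow> bool" where
  "has_score \<Theta> p \<theta> y d \<longleftrightarrow>
     \<theta> islimpt \<Theta> \<and> p \<theta> y > 0 \<and> (\<forall>\<^sub>F t in at \<theta> within \<Theta>. p t y > 0) \<and>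
     ((\<lambda>t. ln (p t y)) has_real_derivative d) (at \<theta> within \<Theta>)"

definition fisher_info ::
  "'y measure \<Rightarrow> (real \<Rightarrow> 'y \<Rightarrow> real) \<Rightarrow> (real \<Rightarrow> 'y \<Rightarrow> real) \<Rightarrow> real \<Rightarrow> real" where
  "fisher_info \<mu> p s \<theta> = (\<integral>y. (s \<theta> y)\<^sup>2 \<partial>model \<mu> p \<theta>)"

definition scaled_score ::
  "'y measure \<Rightarrow> (real \<Rightarrow> 'y \<Rightarrow> real) \<Rightarrow> (real \<Rightarrow> 'y \<Rightarrow> real) \<Rightarrow> real \<Rightarrow> 'y \<Rightarrow> real" where
  "scaled_score \<mu> p s \<theta> y = inverse (fisher_info \<mu> p s \<theta>) * s \<theta> y"

(* f is continuously differentiable in a neighbourhood of x, relative to its domain D. *)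
definition C1_near :: "real set \<Rightarrow> (real \<Rightarrow> real) \<Rightarrow> real \<Rightarrow> bool" where
  "C1_near D f x \<longleftrightarrow>
     (\<exists>U f'. open U \<and> x \<in> U \<and> continuous_on (U \<inter> D) f' \<and>
       (\<forall>t\<in>U \<inter> D. (f has_real_derivative f' t) (at t within D)))"

(* The sigma-algebra generated by Ys 1, ..., Ys i. *)
definition past :: "'y measure \<Rightarrow> 'w measure \<Rightarrow> (nat \<Rightarrow> 'w \<Rightarrow> 'y) \<Rightarrow> nat \<Rightarrow> 'w measure" where
  "past \<mu> W Ys i =
     vimage_algebra (space W) (\<lambda>w. \<lambda>j\<in>{1..i}. Ys j w) (Pi\<^sub>M {1..i} (\<lambda>_. \<mu>))"

(* Given data of size n with estimate t, the probability space W carries the simulated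
   observations Ys 1, Ys 2, ... and the iterates T 0, T 1, ...; the observed data are fixed, so
   conditioning on them and on the simulated past is conditioning on the simulated past in W. *)
definition posterior_scheme ::
  "'y measure \<Rightarrow> real set \<Rightarrow> (real \<Rightarrow> 'y \<Rightarrow> real) \<Rightarrow> (real \<Rightarrow> 'y \<Rightarrow> real) \<Rightarrow> nat \<Rightarrow> real \<Rightarrow>
   'w measure \<Rightarrow> (nat \<Rightarrow> 'w \<Rightarrow> 'y) \<Rightarrow> (nat \<Rightarrow> 'w \<Rightarrow> real) \<Rightarrow> bool" where
  "posterior_scheme \<mu> \<Theta> p s n t W Ys T \<longleftrightarrow>
     prob_space W \<and>
     (\<forall>i\<ge>1. Ys i \<in> W \<rightarrow>\<^sub>M \<mu>) \<and>
     (\<forall>i. T i \<in> borel_measurable W) \<and>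
     (AE w in W. T 0 w = t) \<and>
     (\<forall>i. \<forall>A\<in>sets \<mu>. AE w in W.
        real_cond_exp W (past \<mu> W Ys i) (\<lambda>w. indicator A (Ys (Suc i) w)) w
          = measure (model \<mu> p (T i w)) A) \<and>
     (\<forall>i. AE w in W.
        T (Suc i) w = T i w + inverse (real (n + Suc i)) * scaled_score \<mu> p s (T i w) (Ys (Suc i) w)) \<and>
     (\<forall>i. AE w in W. T i w \<in> \<Theta>)"

definition post_rate :: "nat \<Rightarrow> real" where
  "post_rate n = sqrt (\<Sum>i. inverse ((real (n + 1 + i))\<^sup>2))"

(* For almost all w, T i w converges; the value of lim elsewhere is immaterial. *)
definition posterior_limit :: "(nat \<Rightarrow> 'w \<Rightarrow> real) \<Rightarrow> 'w \<Rightarrow> real" where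
  "posterior_limit T w = lim (\<lambda>i. T i w)"

definition normal_dist :: "real \<Rightarrow> real \<Rightarrow> real measure" where
  "normal_dist m v = density lborel (\<lambda>x. ennreal (normal_density m (sqrt v) x))"

end

theory Submission
  imports Defs
begin

text \<open>
  Fix the data. Conditionally on the simulated past the increments of the recursion are centred
  with variance \<open>v(\<theta>) / (n + i)\<^sup>2\<close>, where \<open>v = 1 / I\<close> is evaluated at the current iterate, and the
  fourth-moment bound gives \<open>v(\<theta>) \<le> A (1 + (\<theta> - \<theta>*)\<^sup>2)\<close>. Hence \<open>1 + E(T\<^sub>i - \<theta>*)\<^sup>2\<close> grows at most by the factor
  \<open>exp (A r\<^sub>n\<^sup>2)\<close> in all, so that the second moments \<open>E(T\<^sub>i - \<theta>*)\<^sup>2\<close> tend to 0 uniformly in \<open>i\<close> as \<open>n\<close> grows.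
  On the other hand, for each \<open>\<epsilon> > 0\<close> there is \<open>K\<close> such that the characteristic function of the scaled score under
  \<open>p\<^sub>\<theta>\<close> at a small argument \<open>c\<close> differs from that of a normal variable with variance \<open>v(\<theta>*)\<close> by at most
  \<open>c\<^sup>2 (\<epsilon> + K (\<theta> - \<theta>*)\<^sup>2)\<close>, for all \<open>\<theta>\<close>: near \<open>\<theta>*\<close> this is continuity of \<open>v\<close> and a third moment bound, away from
  \<open>\<theta>*\<close> it is the quadratic growth of \<open>v\<close>. Replacing the increments by normal ones one at a time therefore costs at
  most \<open>u\<^sup>2 (\<epsilon> + K sup\<^sub>i E(T\<^sub>i - \<theta>*)\<^sup>2)\<close> in total, and Levy's continuity theorem applies.
\<close>

section \<open>Disintegration along a conditional law\<close>

text \<open>\<open>\<kappa>\<close> is a regular conditional law of \<open>Y\<close> given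
  \<open>F\<close>. The defining identity is demanded on rectangles only, which is the form that
  conditional expectations of indicators provide.\<close>

locale conditional_kernel = prob_space M for M :: "'w measure" +
  fixes F :: "'w measure" and N :: "'y measure" and Y :: "'w \<Rightarrow> 'y" and \<kappa> :: "'w \<Rightarrow> 'y measure"
  assumes subalg: "subalgebra M F"
    and Y_measurable [measurable]: "Y \<in> M \<rightarrow>\<^sub>M N"
    and kernel_measurable [measurable]: "\<kappa> \<in> F \<rightarrow>\<^sub>M prob_algebra N"
    and kernel_rectangle: "\<And>A B. A \<in> sets F \<Longrightarrow> B \<in> sets N \<Longrightarrow>
      emeasure M (A \<inter> Y -` B) = (\<integral>\<^sup>+w. indicator A w * emeasure (\<kappa> w) B \<partial>M)"
begin

lemma space_F: "space F = space M"
  using subalg by (simp add: subalgebra_def)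

lemma measurable_F: "f \<in> F \<rightarrow>\<^sub>M L \<Longrightarrow> f \<in> M \<rightarrow>\<^sub>M L"
  by (rule measurable_from_subalg[OF subalg])

lemma pair_measurable [measurable]: "(\<lambda>w. (w, Y w)) \<in> M \<rightarrow>\<^sub>M F \<Otimes>\<^sub>M N"
  by (rule measurable_Pair[OF measurable_F[OF measurable_ident] Y_measurable, unfolded id_def])

lemma sets_kernel_eq: "w \<in> space M \<Longrightarrow> sets (\<kappa> w) = sets N"
  using measurable_space[OF kernel_measurable] by (auto simp: space_F space_prob_algebra)

lemma prob_space_kernel: "w \<in> space M \<Longrightarrow> prob_space (\<kappa> w)"
  using measurable_space[OF kernel_measurable] by (auto simp: space_F space_prob_algebra)

lemma joint_kernel_measurable:
  "(\<lambda>w. distr (\<kappa> w) (F \<Otimes>\<^sub>M N) (Pair w)) \<in> restr_to_subalg M F \<rightarrow>\<^sub>M prob_algebra (F \<Otimes>\<^sub>M N)"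
  by (rule measurable_in_subalg[OF subalg], rule measurable_distr_prob_space2[where M=N]) auto

text \<open>Rectangles form an intersection-stable generator of the product sigma-algebra, and on
  \<open>A \<times> B\<close> both sides reduce to \<open>kernel_rectangle\<close>. The base measure
  is restricted to \<open>F\<close> so that the mixture runs over the sigma-algebra for which the
  kernel is measurable.\<close>

lemma joint_law:
  "distr M (F \<Otimes>\<^sub>M N) (\<lambda>w. (w, Y w)) =
    Giry_Monad.bind (restr_to_subalg M F) (\<lambda>w. distr (\<kappa> w) (F \<Otimes>\<^sub>M N) (Pair w))"
  (is "?D = Giry_Monad.bind ?R ?K")
proof -
  let ?E = "{a \<times> b | a b. a \<in> sets F \<and> b \<in> sets N}"
  have ne: "space ?R \<noteq> {}"
    using not_empty by (simp add: space_restr_to_subalg)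
  have K: "?K \<in> ?R \<rightarrow>\<^sub>M subprob_algebra (F \<Otimes>\<^sub>M N)"
    by (rule measurable_prob_algebraD[OF joint_kernel_measurable])
  show ?thesis
  proof (rule measure_eqI_generator_eq[OF Int_stable_pair_measure_generator[of F N],
        where \<Omega>="space (F \<Otimes>\<^sub>M N)" and A="\<lambda>_. space (F \<Otimes>\<^sub>M N)"])
    show "?E \<subseteq> Pow (space (F \<Otimes>\<^sub>M N))"
      using sets.space_closed[of F] sets.space_closed[of N] by (auto simp: space_pair_measure)
    show "sets ?D = sigma_sets (space (F \<Otimes>\<^sub>M N)) ?E"
      by (simp add: sets_pair_measure space_pair_measure)
    have "sets (Giry_Monad.bind ?R ?K) = sets (F \<Otimes>\<^sub>M N)"
      by (rule sets_bind[OF _ ne]) simp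
    then show "sets (Giry_Monad.bind ?R ?K) = sigma_sets (space (F \<Otimes>\<^sub>M N)) ?E"
      by (simp add: sets_pair_measure space_pair_measure)
    interpret D: prob_space ?D
      by (rule prob_space_distr) simp
    show "emeasure ?D (space (F \<Otimes>\<^sub>M N)) \<noteq> \<infinity>"
      using D.emeasure_space_1 by simp
    show "range (\<lambda>_. space (F \<Otimes>\<^sub>M N)) \<subseteq> ?E"
      unfolding space_pair_measure by blast
    show "(\<Union>i. space (F \<Otimes>\<^sub>M N)) = space (F \<Otimes>\<^sub>M N)"
      by simp
  next
    fix X assume "X \<in> ?E"
    then obtain A B where X: "X = A \<times> B" and A[measurable]: "A \<in> sets F" and B[measurable]: "B \<in> sets N"
      by auto
    have XX: "X \<in> sets (F \<Otimes>\<^sub>M N)"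
      unfolding X by simp
    have AM: "A \<in> sets M" using A subalg by (auto simp: subalgebra_def)
    have "emeasure ?D X = emeasure M (A \<inter> Y -` B)"
      using sets.sets_into_space[OF AM]
      by (subst emeasure_distr[OF _ XX]) (auto simp: X intro!: arg_cong[where f="emeasure M"])
    also have "\<dots> = (\<integral>\<^sup>+w. indicator A w * emeasure (\<kappa> w) B \<partial>M)"
      by (rule kernel_rectangle) fact+
    also have "\<dots> = (\<integral>\<^sup>+w. indicator A w * emeasure (\<kappa> w) B \<partial>?R)"
      by (rule nn_integral_subalgebra2[OF subalg, symmetric])
        (use measurable_prob_algebraD[OF kernel_measurable] in measurable)
    also have "\<dots> = (\<integral>\<^sup>+w. emeasure (?K w) X \<partial>?R)"
    proof (rule nn_integral_cong)
      fix w assume "w \<in> space ?R"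
      then have w: "w \<in> space M" "w \<in> space F" by (auto simp: space_restr_to_subalg space_F)
      have [measurable_cong]: "sets (\<kappa> w) = sets N" by (rule sets_kernel_eq[OF w(1)])
      have m: "Pair w \<in> \<kappa> w \<rightarrow>\<^sub>M F \<Otimes>\<^sub>M N"
        using w by simp
      have "Pair w -` X \<inter> space (\<kappa> w) = (if w \<in> A then B else {})"
        using sets.sets_into_space[OF B] sets_eq_imp_space_eq[OF sets_kernel_eq[OF w(1)]]
        by (auto simp: X)
      then show "indicator A w * emeasure (\<kappa> w) B = emeasure (?K w) X"
        by (subst emeasure_distr[OF m XX]) auto
    qed
    also have "\<dots> = emeasure (Giry_Monad.bind ?R ?K) X"
      by (rule emeasure_bind[OF ne K XX, symmetric])
    finally show "emeasure ?D X = emeasure (Giry_Monad.bind ?R ?K) X" .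
  qed
qed

lemma nn_integral_kernel:
  assumes f[measurable]: "(\<lambda>(w, y). f w y) \<in> borel_measurable (F \<Otimes>\<^sub>M N)"
  shows "(\<integral>\<^sup>+w. f w (Y w) \<partial>M) = (\<integral>\<^sup>+w. \<integral>\<^sup>+y. f w y \<partial>\<kappa> w \<partial>M)"
proof -
  have "(\<integral>\<^sup>+w. f w (Y w) \<partial>M) = (\<integral>\<^sup>+z. case_prod f z \<partial>distr M (F \<Otimes>\<^sub>M N) (\<lambda>w. (w, Y w)))"
    by (subst nn_integral_distr) auto
  also have "\<dots> = (\<integral>\<^sup>+w. \<integral>\<^sup>+z. case_prod f z \<partial>distr (\<kappa> w) (F \<Otimes>\<^sub>M N) (Pair w) \<partial>restr_to_subalg M F)"
    unfolding joint_law by (rule nn_integral_bind[OF f measurable_prob_algebraD[OF joint_kernel_measurable]])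
  also have "\<dots> = (\<integral>\<^sup>+w. \<integral>\<^sup>+y. f w y \<partial>\<kappa> w \<partial>restr_to_subalg M F)"
  proof (rule nn_integral_cong)
    fix w assume "w \<in> space (restr_to_subalg M F)"
    then have w: "w \<in> space M" "w \<in> space F" by (auto simp: space_restr_to_subalg space_F)
    have [measurable_cong]: "sets (\<kappa> w) = sets N" by (rule sets_kernel_eq[OF w(1)])
    show "(\<integral>\<^sup>+z. case_prod f z \<partial>distr (\<kappa> w) (F \<Otimes>\<^sub>M N) (Pair w)) = (\<integral>\<^sup>+y. f w y \<partial>\<kappa> w)"
      using w by (subst nn_integral_distr) auto
  qed
  also have "\<dots> = (\<integral>\<^sup>+w. \<integral>\<^sup>+y. f w y \<partial>\<kappa> w \<partial>M)"
    by (rule nn_integral_subalgebra2[OF subalg],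
        rule nn_integral_measurable_subprob_algebra2[OF f measurable_prob_algebraD[OF kernel_measurable]])
  finally show ?thesis .
qed

text \<open>The integrand varies with \<open>w\<close> too, so the integral is read as that of the
  fixed function \<open>case_prod f\<close> against the law of \<open>(w, y)\<close> with
  \<open>y\<close> drawn from \<open>\<kappa> w\<close>, which is again a measurable kernel.\<close>

lemma kernel_integral_measurable:
  fixes f :: "'w \<Rightarrow> 'y \<Rightarrow> 'c::{banach, second_countable_topology}"
  assumes f[measurable]: "(\<lambda>(w, y). f w y) \<in> borel_measurable (F \<Otimes>\<^sub>M N)"
  shows "(\<lambda>w. \<integral>y. f w y \<partial>\<kappa> w) \<in> borel_measurable F"
proof -
  have "(\<lambda>w. \<integral>z. case_prod f z \<partial>distr (\<kappa> w) (F \<Otimes>\<^sub>M N) (Pair w)) \<in> borel_measurable F"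
    by (rule measurable_compose[OF measurable_prob_algebraD[OF measurable_in_subalg'[OF subalg joint_kernel_measurable]]
          integral_measurable_subprob_algebra[OF f]])
  also have "?this \<longleftrightarrow> ?thesis"
  proof (rule measurable_cong)
    fix w assume w: "w \<in> space F"
    have [measurable_cong]: "sets (\<kappa> w) = sets N" using w by (intro sets_kernel_eq) (simp add: space_F)
    show "(\<integral>z. case_prod f z \<partial>distr (\<kappa> w) (F \<Otimes>\<^sub>M N) (Pair w)) = (\<integral>y. f w y \<partial>\<kappa> w)"
      using w by (subst integral_distr) auto
  qed
  finally show ?thesis .
qed

text \<open>The disintegration for signed integrands. It is applied to real and imaginary parts of
  unimodular functions, so the uniform bound costs nothing.\<close>

lemma integral_kernel_real:
  fixes f :: "'w \<Rightarrow> 'y \<Rightarrow> real"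
  assumes f[measurable]: "(\<lambda>(w, y). f w y) \<in> borel_measurable (F \<Otimes>\<^sub>M N)"
    and bound: "\<And>w y. \<bar>f w y\<bar> \<le> c"
  shows "(\<integral>w. f w (Y w) \<partial>M) = (\<integral>w. (\<integral>y. f w y \<partial>\<kappa> w) \<partial>M)"
proof -
  have fin: "finite_measure (restr_to_subalg M F)"
    by (rule finite_measure_restr_to_subalg[OF subalg]) unfold_locales
  have "(\<integral>w. f w (Y w) \<partial>M) = (\<integral>z. case_prod f z \<partial>distr M (F \<Otimes>\<^sub>M N) (\<lambda>w. (w, Y w)))"
    by (subst integral_distr) auto
  also have "\<dots> = (\<integral>w. \<integral>z. case_prod f z \<partial>distr (\<kappa> w) (F \<Otimes>\<^sub>M N) (Pair w) \<partial>restr_to_subalg M F)"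
    unfolding joint_law
  proof (rule integral_bind[OF f _ measurable_prob_algebraD[OF joint_kernel_measurable] fin, where B'=1])
    show "AE w in restr_to_subalg M F. emeasure (distr (\<kappa> w) (F \<Otimes>\<^sub>M N) (Pair w))
        (space (distr (\<kappa> w) (F \<Otimes>\<^sub>M N) (Pair w))) \<le> ennreal 1"
    proof (rule AE_I2)
      fix w assume "w \<in> space (restr_to_subalg M F)"
      then have "prob_space (distr (\<kappa> w) (F \<Otimes>\<^sub>M N) (Pair w))"
        using measurable_space[OF joint_kernel_measurable] by (simp add: space_prob_algebra)
      then show "emeasure (distr (\<kappa> w) (F \<Otimes>\<^sub>M N) (Pair w))
        (space (distr (\<kappa> w) (F \<Otimes>\<^sub>M N) (Pair w))) \<le> ennreal 1"
        by (simp only: prob_space.emeasure_space_1 ennreal_1)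
    qed
  qed (use bound in auto)
  also have "\<dots> = (\<integral>w. (\<integral>y. f w y \<partial>\<kappa> w) \<partial>restr_to_subalg M F)"
  proof (rule Bochner_Integration.integral_cong[OF refl])
    fix w assume "w \<in> space (restr_to_subalg M F)"
    then have w: "w \<in> space M" "w \<in> space F" by (auto simp: space_restr_to_subalg space_F)
    have [measurable_cong]: "sets (\<kappa> w) = sets N" by (rule sets_kernel_eq[OF w(1)])
    show "(\<integral>z. case_prod f z \<partial>distr (\<kappa> w) (F \<Otimes>\<^sub>M N) (Pair w)) = (\<integral>y. f w y \<partial>\<kappa> w)"
      using w by (subst integral_distr) auto
  qed
  also have "\<dots> = (\<integral>w. (\<integral>y. f w y \<partial>\<kappa> w) \<partial>M)"
    by (rule integral_subalgebra2[OF subalg kernel_integral_measurable[OF f]])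
  finally show ?thesis .
qed

lemma norm_integral_kernel_le:
  fixes f :: "'y \<Rightarrow> 'c::{banach, second_countable_topology}"
  assumes "w \<in> space M" "\<And>y. norm (f y) \<le> c"
  shows "norm (\<integral>y. f y \<partial>\<kappa> w) \<le> c"
proof -
  interpret K: prob_space "\<kappa> w" by (rule prob_space_kernel[OF assms(1)])
  \<comment> \<open>The bound at an arbitrary point forces \<open>c\<close> to be non-negative. This
    settles the non-integrable case, where the integral is 0 by convention.\<close>
  have c: "0 \<le> c" using assms(2)[of undefined] norm_ge_zero order_trans by blast
  show ?thesis
  proof (cases "integrable (\<kappa> w) f")
    case True
    have "norm (\<integral>y. f y \<partial>\<kappa> w) \<le> (\<integral>y. norm (f y) \<partial>\<kappa> w)" by (rule integral_norm_bound)
    also have "\<dots> \<le> (\<integral>y. c \<partial>\<kappa> w)"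
      using True assms(2) by (intro integral_mono) auto
    finally show ?thesis by (simp add: K.prob_space)
  qed (simp add: not_integrable_integral_eq c)
qed

lemma integral_kernel_complex:
  fixes f :: "'w \<Rightarrow> 'y \<Rightarrow> complex"
  assumes f[measurable]: "(\<lambda>(w, y). f w y) \<in> borel_measurable (F \<Otimes>\<^sub>M N)"
    and bound: "\<And>w y. norm (f w y) \<le> c"
  shows "(\<integral>w. f w (Y w) \<partial>M) = (\<integral>w. (\<integral>y. f w y \<partial>\<kappa> w) \<partial>M)"
proof -
  have f': "(\<lambda>(w, y). Re (f w y)) \<in> borel_measurable (F \<Otimes>\<^sub>M N)" "(\<lambda>(w, y). Im (f w y)) \<in> borel_measurable (F \<Otimes>\<^sub>M N)"
    by measurable
  have I: "integrable M (\<lambda>w. f w (Y w))"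
  proof (rule integrable_const_bound[where B=c])
    show "(\<lambda>w. f w (Y w)) \<in> borel_measurable M"
      using measurable_compose[OF pair_measurable f] by simp
  qed (simp add: bound)
  have Ik: "integrable (\<kappa> w) (f w)" if w: "w \<in> space M" for w
  proof -
    interpret K: prob_space "\<kappa> w" by (rule prob_space_kernel[OF w])
    have "f w \<in> borel_measurable N"
      using measurable_compose[OF measurable_Pair1' f, of w] w by (simp add: space_F)
    then have "f w \<in> borel_measurable (\<kappa> w)"
      unfolding measurable_cong_sets[OF sets_kernel_eq[OF w] refl] .
    then show ?thesis
      by (rule K.integrable_const_bound[rotated]) (rule AE_I2, rule bound)
  qed
  have Io: "integrable M (\<lambda>w. \<integral>y. f w y \<partial>\<kappa> w)"
    by (rule integrable_const_bound[where B=c])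
       (rule AE_I2, erule norm_integral_kernel_le, rule bound,
        rule measurable_F[OF kernel_integral_measurable[OF f]])
  show ?thesis
  proof (rule complex_eqI)
    have "Re (\<integral>w. f w (Y w) \<partial>M) = (\<integral>w. Re (f w (Y w)) \<partial>M)" using I by simp
    also have "\<dots> = (\<integral>w. (\<integral>y. Re (f w y) \<partial>\<kappa> w) \<partial>M)"
      by (rule integral_kernel_real[OF f'(1)]) (rule order_trans[OF abs_Re_le_cmod bound])
    also have "\<dots> = (\<integral>w. Re (\<integral>y. f w y \<partial>\<kappa> w) \<partial>M)"
      by (intro Bochner_Integration.integral_cong refl) (simp add: Ik)
    finally show "Re (\<integral>w. f w (Y w) \<partial>M) = Re (\<integral>w. (\<integral>y. f w y \<partial>\<kappa> w) \<partial>M)" using Io by simp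
  next
    have "Im (\<integral>w. f w (Y w) \<partial>M) = (\<integral>w. Im (f w (Y w)) \<partial>M)" using I by simp
    also have "\<dots> = (\<integral>w. (\<integral>y. Im (f w y) \<partial>\<kappa> w) \<partial>M)"
      by (rule integral_kernel_real[OF f'(2)]) (rule order_trans[OF abs_Im_le_cmod bound])
    also have "\<dots> = (\<integral>w. Im (\<integral>y. f w y \<partial>\<kappa> w) \<partial>M)"
      by (intro Bochner_Integration.integral_cong refl) (simp add: Ik)
    finally show "Im (\<integral>w. f w (Y w) \<partial>M) = Im (\<integral>w. (\<integral>y. f w y \<partial>\<kappa> w) \<partial>M)" using Io by simp
  qed
qed

end

section \<open>Almost sure convergence from quadratic increments\<close>

text \<open>Along the cubes the increments are summable, and inside a block between consecutive cubes even the sum of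
  all squared deviations from its left end is small in mean; no maximal inequality is needed.\<close>

lemma AE_convergent_of_quadratic_increments:
  fixes X :: "nat \<Rightarrow> 'w \<Rightarrow> real"
  assumes X[measurable]: "\<And>m. X m \<in> borel_measurable M"
    and D: "0 \<le> D"
    and incr: "\<And>k m. 1 \<le> k \<Longrightarrow> k \<le> m \<Longrightarrow>
      (\<integral>\<^sup>+w. ennreal ((X m w - X k w)\<^sup>2) \<partial>M) \<le> ennreal (D * (real m - real k) / (real k)\<^sup>2)"
  shows "AE w in M. convergent (\<lambda>m. X m w)"
proof -
  \<comment> \<open>With s = k + 1, the block starting at s^3 has length at most 7 s^2, and a
    deviation inside it has mean square of order s^2 / s^6 = s^-4. A sum of order s^2 such terms and
    a single term weighted by s^2 are then both of order s^-2, which is summable. Starting at 1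
    keeps the denominator in \<open>incr\<close> positive.\<close>
  define q where "q k = (Suc k) ^ 3" for k :: nat
  \<comment> \<open>The first summand controls the whole block; the weight in the second yields
    absolute summability of the increments along the cubes.\<close>
  define U where "U k w = (\<Sum>m\<in>{q k..<q (Suc k)}. (X m w - X (q k) w)\<^sup>2)
      + (real (Suc k))\<^sup>2 * (X (q (Suc k)) w - X (q k) w)\<^sup>2" for k w
  have U_nonneg: "0 \<le> U k w" for k w
    unfolding U_def by (intro add_nonneg_nonneg sum_nonneg mult_nonneg_nonneg) auto
  have U_measurable [measurable]: "U k \<in> borel_measurable M" for k
    unfolding U_def by measurable
  have q1: "1 \<le> q k" for k unfolding q_def by simp
  have qm: "q k \<le> q (Suc k)" for k unfolding q_def by (rule power_mono) auto
  have gap: "real (q (Suc k)) - real (q k) \<le> 7 * (real (Suc k))\<^sup>2" for k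
    unfolding q_def by (simp add: power2_eq_square power3_eq_cube algebra_simps)
  have qsq: "(real (q k))\<^sup>2 = (real (Suc k)) ^ 6" for k
    unfolding q_def by (simp add: power_mult[symmetric])
  have in_block: "(\<integral>\<^sup>+w. ennreal ((X m w - X (q k) w)\<^sup>2) \<partial>M) \<le> ennreal (7 * D / (real (Suc k)) ^ 4)"
    if "q k \<le> m" "m \<le> q (Suc k)" for k m
  proof -
    have "D * (real m - real (q k)) / (real (q k))\<^sup>2 \<le> D * (7 * (real (Suc k))\<^sup>2) / (real (Suc k)) ^ 6"
      unfolding qsq using gap[of k] that D by (intro divide_right_mono mult_left_mono) auto
    also have "\<dots> = 7 * D / (real (Suc k)) ^ 4"
      by (simp add: divide_simps)
    finally show ?thesis
      using incr[OF q1 that(1)] by (meson ennreal_leI order_trans)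
  qed
  \<comment> \<open>With s = k + 1, the block sum contributes at most 7 s^2 copies of
    \<open>?e\<close> and the weighted term s^2 copies; hence 8 * 7 = 56.\<close>
  have EU: "(\<integral>\<^sup>+w. ennreal (U k w) \<partial>M) \<le> ennreal (56 * D / (real (Suc k))\<^sup>2)" for k
  proof -
    let ?e = "7 * D / (real (Suc k)) ^ 4"
    have e: "0 \<le> ?e" using D by simp
    have "(\<integral>\<^sup>+w. ennreal (U k w) \<partial>M) =
      (\<integral>\<^sup>+w. (\<Sum>m\<in>{q k..<q (Suc k)}. ennreal ((X m w - X (q k) w)\<^sup>2))
        + ennreal ((real (Suc k))\<^sup>2) * ennreal ((X (q (Suc k)) w - X (q k) w)\<^sup>2) \<partial>M)"
      unfolding U_def
      by (subst ennreal_plus) (auto simp: sum_ennreal ennreal_mult intro!: sum_nonneg nn_integral_cong)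
    also have "\<dots> = (\<Sum>m\<in>{q k..<q (Suc k)}. \<integral>\<^sup>+w. ennreal ((X m w - X (q k) w)\<^sup>2) \<partial>M)
        + ennreal ((real (Suc k))\<^sup>2) * (\<integral>\<^sup>+w. ennreal ((X (q (Suc k)) w - X (q k) w)\<^sup>2) \<partial>M)"
      by (simp add: nn_integral_add nn_integral_sum nn_integral_cmult del: sum_ennreal)
    also have "\<dots> \<le> (\<Sum>m\<in>{q k..<q (Suc k)}. ennreal ?e) + ennreal ((real (Suc k))\<^sup>2) * ennreal ?e"
      using in_block qm by (intro add_mono sum_mono mult_left_mono) auto
    also have "\<dots> = ennreal (real (q (Suc k) - q k) * ?e + (real (Suc k))\<^sup>2 * ?e)"
      using e D by (simp add: ennreal_mult[symmetric] ennreal_of_nat_eq_real_of_nat ennreal_plus[symmetric] del: ennreal_plus)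
    also have "\<dots> \<le> ennreal (8 * (real (Suc k))\<^sup>2 * ?e)"
    proof (rule ennreal_leI)
      have "real (q (Suc k) - q k) * ?e \<le> 7 * (real (Suc k))\<^sup>2 * ?e"
        using gap[of k] qm[of k] e by (intro mult_right_mono) auto
      moreover have "8 * (real (Suc k))\<^sup>2 * e = 7 * (real (Suc k))\<^sup>2 * e + (real (Suc k))\<^sup>2 * e" for e
        by simp
      ultimately show "real (q (Suc k) - q k) * ?e + (real (Suc k))\<^sup>2 * ?e \<le> 8 * (real (Suc k))\<^sup>2 * ?e"
        by (simp only: add_right_mono)
    qed
    also have "8 * (real (Suc k))\<^sup>2 * ?e = 56 * D / (real (Suc k))\<^sup>2"
      by (simp add: divide_simps)
    finally show ?thesis .
  qed
  have sq_summable: "summable (\<lambda>k. inverse ((real (Suc k))\<^sup>2))"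
    using inverse_power_summable[of 2, where 'a=real] by (subst summable_Suc_iff) simp
  have "(\<integral>\<^sup>+w. (\<Sum>k. ennreal (U k w)) \<partial>M) = (\<Sum>k. \<integral>\<^sup>+w. ennreal (U k w) \<partial>M)"
    by (rule nn_integral_suminf) simp
  also have "\<dots> \<le> (\<Sum>k. ennreal (56 * D / (real (Suc k))\<^sup>2))"
    by (rule suminf_le[OF EU]) auto
  also have "\<dots> = ennreal (\<Sum>k. 56 * D * inverse ((real (Suc k))\<^sup>2))"
    unfolding divide_inverse using D
    by (intro suminf_ennreal2 summable_mult sq_summable) auto
  finally have "(\<integral>\<^sup>+w. (\<Sum>k. ennreal (U k w)) \<partial>M) \<noteq> \<infinity>"
    by (metis ennreal_neq_top infinity_ennreal_def neq_top_trans)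
  then have "AE w in M. (\<Sum>k. ennreal (U k w)) \<noteq> \<infinity>"
    by (intro nn_integral_PInf_AE) auto
  then show ?thesis
  proof eventually_elim
    case (elim w)
    have sU: "summable (\<lambda>k. U k w)"
      using elim U_nonneg by (intro summable_suminf_not_top) auto
    have "summable (\<lambda>k. X (q (Suc k)) w - X (q k) w)"
    proof (rule summable_comparison_test')
      show "summable (\<lambda>k. inverse ((real (Suc k))\<^sup>2) + U k w)"
        by (intro summable_add sq_summable sU)
      fix k :: nat
      \<comment> \<open>The arithmetic-geometric mean inequality, read off from the square of 1/s -
        s |d|.\<close>
      have *: "\<bar>d\<bar> \<le> inverse (s\<^sup>2) + u" if "0 < s" "s\<^sup>2 * d\<^sup>2 \<le> u" for s d u :: real
      proof -
        have "0 \<le> (inverse s - s * \<bar>d\<bar>)\<^sup>2" by simp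
        also have "\<dots> = inverse (s\<^sup>2) + s\<^sup>2 * d\<^sup>2 - 2 * \<bar>d\<bar>"
          using that by (simp add: power2_diff power_mult_distrib power_inverse)
        finally show ?thesis using that(2) abs_ge_zero[of d] by linarith
      qed
      have "(real (Suc k))\<^sup>2 * (X (q (Suc k)) w - X (q k) w)\<^sup>2 \<le> U k w"
        unfolding U_def by (simp add: sum_nonneg)
      then show "norm (X (q (Suc k)) w - X (q k) w) \<le> inverse ((real (Suc k))\<^sup>2) + U k w"
        unfolding real_norm_def by (intro *) auto
    qed
    then have "convergent (\<lambda>n. X (q n) w - X (q 0) w)"
      unfolding summable_iff_convergent sum_lessThan_telescope[of "\<lambda>n. X (q n) w"] .
    then have "convergent (\<lambda>n. X (q n) w)" by (simp add: convergent_diff_const_right_iff)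
    then obtain L where L: "(\<lambda>n. X (q n) w) \<longlonglongrightarrow> L" by (auto simp: convergent_def)
    have "(\<lambda>m. X m w) \<longlonglongrightarrow> L"
    proof (rule LIMSEQ_I)
      fix e :: real assume e: "0 < e"
      have "\<forall>\<^sub>F k in sequentially. U k w < (e/2)\<^sup>2"
        by (rule order_tendstoD(2)[OF summable_LIMSEQ_zero[OF sU]]) (use e in simp)
      moreover have "\<forall>\<^sub>F k in sequentially. dist (X (q k) w) L < e/2"
        by (rule tendstoD[OF L]) (use e in simp)
      ultimately obtain k0 where k0: "\<And>k. k \<ge> k0 \<Longrightarrow> U k w < (e/2)\<^sup>2 \<and> dist (X (q k) w) L < e/2"
        unfolding eventually_sequentially by (metis nle_le order_trans)
      show "\<exists>no. \<forall>m\<ge>no. norm (X m w - L) < e"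
      proof (intro exI allI impI)
        fix m assume m: "q k0 \<le> m"
        \<comment> \<open>\<open>k\<close> is the index of the block containing \<open>m\<close>.
          Since \<open>m\<close> lies beyond \<open>q k0\<close>, this index is at least
          \<open>k0\<close>, and both smallness conditions hold for it.\<close>
        define k where "k = (LEAST k. m < q (Suc k))"
        have "m < q (Suc m)" unfolding q_def by (rule less_le_trans[of _ "Suc (Suc m) ^ 1"]) (simp, rule power_increasing, auto)
        then have k1: "m < q (Suc k)" unfolding k_def by (rule LeastI)
        have kk: "k0 \<le> k"
        proof (rule ccontr)
          assume "\<not> k0 \<le> k"
          then have "q (Suc k) \<le> q k0" unfolding q_def by (intro power_mono) auto
          with m k1 show False by simp
        qed
        have k2: "q k \<le> m"
        proof (cases "k = k0")
          case False
          with kk obtain j where j: "k = Suc j" by (cases k) auto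
          have "\<not> m < q (Suc j)" by (rule not_less_Least) (simp add: k_def[symmetric] j)
          then show ?thesis by (simp add: j)
        qed (use m in simp)
        have "(X m w - X (q k) w)\<^sup>2 \<le> (\<Sum>m\<in>{q k..<q (Suc k)}. (X m w - X (q k) w)\<^sup>2)"
          using k1 k2 by (intro member_le_sum) auto
        also have "\<dots> \<le> U k w" unfolding U_def by simp
        also have "\<dots> < (e/2)\<^sup>2" using k0[OF kk] by simp
        finally have "\<bar>X m w - X (q k) w\<bar> < e/2"
          using e by (subst (asm) power2_abs[symmetric]) (rule power2_less_imp_less, auto)
        with k0[OF kk] show "norm (X m w - L) < e" unfolding dist_real_def real_norm_def by linarith
      qed
    qed
    then show ?case by (auto simp: convergent_def)
  qed
qed

section \<open>Characteristic functions of the scaled score\<close>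

text \<open>The quadratic Taylor polynomials of exp(-x) and exp(x) have product 1 + x^4/4 \<ge> 1,
  and the second one lies below exp(x); this gives the upper bound on exp(-x). The lower bound is
  the tangent line.\<close>

lemma exp_minus_second_order:
  fixes x :: real
  assumes "0 \<le> x"
  shows "\<bar>exp (- x) - (1 - x)\<bar> \<le> x\<^sup>2 / 2"
proof -
  have "1 \<le> (1 - x + x\<^sup>2 / 2) * (1 + x + x\<^sup>2 / 2)"
    using assms by (simp add: algebra_simps power2_eq_square)
  also have "\<dots> \<le> (1 - x + x\<^sup>2 / 2) * exp x"
  proof (rule mult_left_mono[OF exp_lower_Taylor_quadratic[OF assms]])
    have "0 \<le> (1 - x)\<^sup>2 + 1" by simp
    then show "0 \<le> 1 - x + x\<^sup>2 / 2" by (simp add: power2_diff)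
  qed
  finally have "exp (- x) \<le> 1 - x + x\<^sup>2 / 2"
    by (simp add: exp_minus field_simps)
  moreover have "1 - x \<le> exp (- x)" using exp_ge_add_one_self[of "- x"] by simp
  ultimately show ?thesis by simp
qed

text \<open>In the application \<open>Z\<close> is the scaled score and \<open>v\<close> the inverse
  Fisher information. Measurability in the parameter refers to the trace of the Borel sets on
  \<open>\<Theta>\<close>, since \<open>\<Theta>\<close> is an arbitrary set.\<close>

locale centered_family =
  fixes \<Theta> :: "real set" and N :: "'y measure" and P :: "real \<Rightarrow> 'y measure"
    and Z :: "real \<Rightarrow> 'y \<Rightarrow> real" and v :: "real \<Rightarrow> real"
  assumes P_measurable [measurable]: "P \<in> restrict_space borel \<Theta> \<rightarrow>\<^sub>M prob_algebra N"
    and Z_measurable [measurable]: "(\<lambda>(\<theta>, y). Z \<theta> y) \<in> borel_measurable (restrict_space borel \<Theta> \<Otimes>\<^sub>M N)"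
    and Z_integrable: "\<And>\<theta>. \<theta> \<in> \<Theta> \<Longrightarrow> integrable (P \<theta>) (Z \<theta>)"
    and Z_mean: "\<And>\<theta>. \<theta> \<in> \<Theta> \<Longrightarrow> (\<integral>y. Z \<theta> y \<partial>P \<theta>) = 0"
    and Z_square_integrable: "\<And>\<theta>. \<theta> \<in> \<Theta> \<Longrightarrow> integrable (P \<theta>) (\<lambda>y. (Z \<theta> y)\<^sup>2)"
    and Z_variance: "\<And>\<theta>. \<theta> \<in> \<Theta> \<Longrightarrow> (\<integral>y. (Z \<theta> y)\<^sup>2 \<partial>P \<theta>) = v \<theta>"
begin

lemma prob_space_P: "\<theta> \<in> \<Theta> \<Longrightarrow> prob_space (P \<theta>)"
  using measurable_space[OF P_measurable] by (auto simp: space_prob_algebra space_restrict_space)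

lemma v_nonneg: "\<theta> \<in> \<Theta> \<Longrightarrow> 0 \<le> v \<theta>"
  using Z_variance[symmetric] by simp

text \<open>The cross term vanishes by centring. With non-negative integrals the identity passes
  through \<open>nn_integral_kernel\<close> before the iterates are known to be square
  integrable.\<close>

lemma nn_integral_shift_square:
  assumes \<theta>: "\<theta> \<in> \<Theta>"
  shows "(\<integral>\<^sup>+y. ennreal ((h + c * Z \<theta> y)\<^sup>2) \<partial>P \<theta>) = ennreal (h\<^sup>2 + c\<^sup>2 * v \<theta>)"
proof -
  interpret P: prob_space "P \<theta>" by (rule prob_space_P[OF \<theta>])
  note [simp] = Z_integrable[OF \<theta>] Z_square_integrable[OF \<theta>] Z_mean[OF \<theta>] Z_variance[OF \<theta>]
  have eq: "(\<lambda>y. (h + c * Z \<theta> y)\<^sup>2) = (\<lambda>y. h\<^sup>2 + 2 * h * c * Z \<theta> y + c\<^sup>2 * (Z \<theta> y)\<^sup>2)"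
    by (simp add: power2_eq_square algebra_simps)
  have "integrable (P \<theta>) (\<lambda>y. (h + c * Z \<theta> y)\<^sup>2)" unfolding eq by simp
  then have "(\<integral>\<^sup>+y. ennreal ((h + c * Z \<theta> y)\<^sup>2) \<partial>P \<theta>) = ennreal (\<integral>y. (h + c * Z \<theta> y)\<^sup>2 \<partial>P \<theta>)"
    by (rule nn_integral_eq_integral) simp
  also have "(\<integral>y. (h + c * Z \<theta> y)\<^sup>2 \<partial>P \<theta>) = h\<^sup>2 + c\<^sup>2 * v \<theta>"
    unfolding eq by (simp add: P.prob_space)
  finally show ?thesis .
qed

end

section \<open>Quadratic growth of the variance and the Gaussian approximation\<close>

locale quartic_family = centered_family +
  fixes B C :: real
  assumes B_nonneg: "0 \<le> B" and C_nonneg: "0 \<le> C"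
    and fourth_integrable: "\<And>\<theta>. \<theta> \<in> \<Theta> \<Longrightarrow> integrable (P \<theta>) (\<lambda>y. Z \<theta> y ^ 4)"
    and fourth_bound: "\<And>\<theta>. \<theta> \<in> \<Theta> \<Longrightarrow> (\<integral>y. Z \<theta> y ^ 4 \<partial>P \<theta>) \<le> B + C * \<theta> ^ 4"
begin

text \<open>Non-negativity of the variance of Z^2 bounds v^2 by the fourth moment, which is
  dominated by the square of a quadratic polynomial in \<theta>. Taking roots leaves quadratic
  growth, which is then recentred at \<open>a\<close>.\<close>

lemma variance_growth:
  assumes \<theta>: "\<theta> \<in> \<Theta>"
  shows "v \<theta> \<le> (1 + B + (1 + C) * (2 * a\<^sup>2 + 2)) * (1 + (\<theta> - a)\<^sup>2)"
proof -
  interpret P: prob_space "P \<theta>" by (rule prob_space_P[OF \<theta>])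
  note [simp] = Z_square_integrable[OF \<theta>] Z_variance[OF \<theta>] fourth_integrable[OF \<theta>]
  have "0 \<le> (\<integral>y. ((Z \<theta> y)\<^sup>2 - v \<theta>)\<^sup>2 \<partial>P \<theta>)" by simp
  also have "(\<lambda>y. ((Z \<theta> y)\<^sup>2 - v \<theta>)\<^sup>2) = (\<lambda>y. Z \<theta> y ^ 4 - 2 * v \<theta> * (Z \<theta> y)\<^sup>2 + (v \<theta>)\<^sup>2)"
    by (simp add: power2_eq_square eval_nat_numeral algebra_simps)
  also have "(\<integral>y. Z \<theta> y ^ 4 - 2 * v \<theta> * (Z \<theta> y)\<^sup>2 + (v \<theta>)\<^sup>2 \<partial>P \<theta>) = (\<integral>y. Z \<theta> y ^ 4 \<partial>P \<theta>) - (v \<theta>)\<^sup>2"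
    by (simp add: P.prob_space) (simp add: power2_eq_square)
  finally have "(v \<theta>)\<^sup>2 \<le> B + C * \<theta> ^ 4" using fourth_bound[OF \<theta>] by simp
  also have "\<dots> \<le> ((1 + B) + (1 + C) * \<theta>\<^sup>2)\<^sup>2"
  proof -
    have "B \<le> (1 + B)\<^sup>2" "C \<le> (1 + C)\<^sup>2" using B_nonneg C_nonneg by (auto simp: power2_eq_square algebra_simps)
    then have "B + C * \<theta> ^ 4 \<le> (1 + B)\<^sup>2 + (1 + C)\<^sup>2 * \<theta> ^ 4"
      by (intro add_mono mult_right_mono) auto
    also have "\<dots> = (1 + B)\<^sup>2 + ((1 + C) * \<theta>\<^sup>2)\<^sup>2" by (simp add: power_mult_distrib)
    also have "\<dots> \<le> ((1 + B) + (1 + C) * \<theta>\<^sup>2)\<^sup>2"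
      using B_nonneg C_nonneg by (simp add: power2_sum)
    finally show ?thesis .
  qed
  finally have "v \<theta> \<le> (1 + B) + (1 + C) * \<theta>\<^sup>2"
    by (rule power2_le_imp_le) (use B_nonneg C_nonneg in simp)
  also have "\<theta>\<^sup>2 \<le> (2 * a\<^sup>2 + 2) * (1 + (\<theta> - a)\<^sup>2)"
  proof -
    \<comment> \<open>The parallelogram identity for \<theta> - a and a, whose sum is \<theta> and
      whose difference is \<theta> - 2a.\<close>
    have "\<theta>\<^sup>2 \<le> \<theta>\<^sup>2 + (\<theta> - 2 * a)\<^sup>2" by simp
    also have "\<dots> = 2 * a\<^sup>2 + 2 * (\<theta> - a)\<^sup>2" by (simp add: power2_eq_square algebra_simps)
    also have "\<dots> \<le> (2 * a\<^sup>2 + 2) * (1 + (\<theta> - a)\<^sup>2)" by (simp add: algebra_simps)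
    finally show ?thesis .
  qed
  then have "(1 + B) + (1 + C) * \<theta>\<^sup>2 \<le> (1 + B) * (1 + (\<theta> - a)\<^sup>2) + (1 + C) * ((2 * a\<^sup>2 + 2) * (1 + (\<theta> - a)\<^sup>2))"
    using B_nonneg C_nonneg by (intro add_mono mult_left_mono) (simp_all add: algebra_simps)
  finally show ?thesis by (simp add: algebra_simps)
qed

text \<open>Three errors are added: the second-order expansion of the characteristic function at
  \<theta>, the exchange of v(\<theta>) for v(a), and the second-order expansion of the Gaussian.
  The term with \<open>K\<close> makes the estimate valid on all of \<open>\<Theta>\<close>, so the
  iterates never have to be localised near \<open>a\<close>.\<close>

lemma char_gaussian_approx:
  assumes a: "a \<in> \<Theta>" and cont: "continuous (at a within \<Theta>) v" and \<epsilon>: "0 < \<epsilon>"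
  shows "\<exists>K\<ge>0. \<exists>h>0. \<forall>\<theta>\<in>\<Theta>. \<forall>c. \<bar>c\<bar> \<le> h \<longrightarrow>
    cmod ((\<integral>y. iexp (c * Z \<theta> y) \<partial>P \<theta>) - exp (- (c\<^sup>2 * v a / 2))) \<le> c\<^sup>2 * (\<epsilon> + K * (\<theta> - a)\<^sup>2)"
proof -
  define A where "A = 1 + B + (1 + C) * (2 * a\<^sup>2 + 2)"
  have A: "0 \<le> A" using B_nonneg C_nonneg by (simp add: A_def)
  have vA: "v \<theta> \<le> A * (1 + (\<theta> - a)\<^sup>2)" if "\<theta> \<in> \<Theta>" for \<theta>
    unfolding A_def by (rule variance_growth[OF that])
  obtain d where d: "0 < d" "\<And>\<theta>. \<theta> \<in> \<Theta> \<Longrightarrow> \<bar>\<theta> - a\<bar> < d \<Longrightarrow> \<bar>v \<theta> - v a\<bar> < \<epsilon>"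
    using cont \<epsilon> unfolding continuous_within_eps_delta dist_real_def by metis
  \<comment> \<open>The cap 1 bounds |\<theta>| by |a| + 1 in the near region, and with it the
    fourth moments there.\<close>
  define \<delta> where "\<delta> = min d 1"
  have \<delta>: "0 < \<delta>" "\<delta> \<le> 1" "\<delta> \<le> d" using d(1) by (auto simp: \<delta>_def)
  \<comment> \<open>Away from \<open>a\<close> one has 1 \<le> (\<theta> - a)^2 / \<delta>^2, so
    that v(\<theta>) + v(a) \<le> A (2 + (\<theta> - a)^2) is absorbed by
    \<open>K * (\<theta> - a)\<^sup>2\<close>.\<close>
  define K where "K = A * (2 / \<delta>\<^sup>2 + 1)"
  have K: "0 \<le> K" using A by (simp add: K_def)
  have far: "v \<theta> + v a \<le> K * (\<theta> - a)\<^sup>2" if \<theta>: "\<theta> \<in> \<Theta>" and "\<not> \<bar>\<theta> - a\<bar> < \<delta>" for \<theta>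
  proof -
    have "\<delta>\<^sup>2 \<le> (\<theta> - a)\<^sup>2"
      using that \<delta>(1) by (subst power2_abs[symmetric, of "\<theta> - a"], intro power_mono) auto
    then have "1 \<le> (\<theta> - a)\<^sup>2 / \<delta>\<^sup>2" using \<delta>(1) by simp
    then have "A * 2 \<le> A * (2 * ((\<theta> - a)\<^sup>2 / \<delta>\<^sup>2))" using A by (intro mult_left_mono) auto
    moreover have "v \<theta> + v a \<le> A * 2 + A * (\<theta> - a)\<^sup>2"
      using vA[OF \<theta>] vA[OF a] by (simp add: algebra_simps)
    moreover have "K * (\<theta> - a)\<^sup>2 = A * (2 * ((\<theta> - a)\<^sup>2 / \<delta>\<^sup>2)) + A * (\<theta> - a)\<^sup>2"
      by (simp add: K_def algebra_simps)
    ultimately show ?thesis by linarith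
  qed
  \<comment> \<open>Near \<open>a\<close>, \<open>2 * A\<close> bounds the variance and the
    remaining terms bound the fourth moment.\<close>
  define D where "D = 2 * A + B + C * (\<bar>a\<bar> + 1) ^ 4"
  have D: "0 \<le> D" using A B_nonneg C_nonneg by (simp add: D_def)
  \<comment> \<open>Chosen so that both h D and h v(a)^2 are at most \<epsilon>. The summand 1 keeps
    the denominator positive, and the cap 1 gives c^2 \<le> |c|.\<close>
  define h where "h = min 1 (\<epsilon> / (D + 1 + (v a)\<^sup>2))"
  have Dpos: "0 < D + 1 + (v a)\<^sup>2" using D by (simp add: add_pos_nonneg)
  have h: "0 < h" "h \<le> 1" using \<epsilon> Dpos by (auto simp: h_def)
  have hD: "c * D \<le> \<epsilon>" "c * (v a)\<^sup>2 \<le> \<epsilon>" if "0 \<le> c" "c \<le> h" for c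
  proof -
    have "c * (D + 1 + (v a)\<^sup>2) \<le> \<epsilon> / (D + 1 + (v a)\<^sup>2) * (D + 1 + (v a)\<^sup>2)"
      using that Dpos by (intro mult_right_mono) (auto simp: h_def)
    then have *: "c * (D + 1 + (v a)\<^sup>2) \<le> \<epsilon>" using Dpos by simp
    have "c * D \<le> c * (D + 1 + (v a)\<^sup>2)" "c * (v a)\<^sup>2 \<le> c * (D + 1 + (v a)\<^sup>2)"
      using that D by (auto intro!: mult_left_mono)
    with * show "c * D \<le> \<epsilon>" "c * (v a)\<^sup>2 \<le> \<epsilon>" by auto
  qed
  have main: "cmod ((\<integral>y. iexp (c * Z \<theta> y) \<partial>P \<theta>) - exp (- (c\<^sup>2 * v a / 2))) \<le> c\<^sup>2 * (\<epsilon> + 2 * K * (\<theta> - a)\<^sup>2)"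
    if \<theta>: "\<theta> \<in> \<Theta>" and c: "\<bar>c\<bar> \<le> h" for \<theta> c
  proof -
    interpret P: prob_space "P \<theta>" by (rule prob_space_P[OF \<theta>])
    note Zi [simp] = Z_integrable[OF \<theta>] Z_square_integrable[OF \<theta>] Z_mean[OF \<theta>] Z_variance[OF \<theta>]
      fourth_integrable[OF \<theta>]
    have Zm [measurable]: "Z \<theta> \<in> borel_measurable (P \<theta>)" using Zi(1) by (rule borel_measurable_integrable)
    \<comment> \<open>The remainder of the second-order expansion. Its cubic branch is used near
      \<open>a\<close>, where the factor |c| makes it small; its quadratic branch is used away from
      \<open>a\<close>, where \<open>K\<close> absorbs the variance.\<close>
    let ?E = "\<integral>y. min (6 * (Z \<theta> y)\<^sup>2) (\<bar>c\<bar> * \<bar>Z \<theta> y\<bar> ^ 3) \<partial>P \<theta>"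
    have int: "integrable (P \<theta>) (\<lambda>y. min (6 * (Z \<theta> y)\<^sup>2) (\<bar>c\<bar> * \<bar>Z \<theta> y\<bar> ^ 3))"
      by (rule Bochner_Integration.integrable_bound[where f="\<lambda>y. 6 * (Z \<theta> y)\<^sup>2"]) auto
    have third: "?E \<le> \<epsilon> + 6 * K * (\<theta> - a)\<^sup>2"
    proof (cases "\<bar>\<theta> - a\<bar> < \<delta>")
      case True
      have "?E \<le> (\<integral>y. \<bar>c\<bar> * ((Z \<theta> y)\<^sup>2 + Z \<theta> y ^ 4) \<partial>P \<theta>)"
      proof (rule integral_mono[OF int])
        fix y
        let ?z = "\<bar>Z \<theta> y\<bar>"
        \<comment> \<open>With z = |Z|, the product is z^4 - z^3 + z^2, so the third absolute moment
          is controlled by the second and fourth.\<close>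
        have "0 \<le> ?z\<^sup>2 * ((?z - 1)\<^sup>2 + ?z)" by simp
        also have "\<dots> = ?z\<^sup>2 + ?z ^ 4 - ?z ^ 3" by (simp add: power2_eq_square eval_nat_numeral algebra_simps)
        finally have "?z ^ 3 \<le> (Z \<theta> y)\<^sup>2 + Z \<theta> y ^ 4" by simp
        then show "min (6 * (Z \<theta> y)\<^sup>2) (\<bar>c\<bar> * \<bar>Z \<theta> y\<bar> ^ 3) \<le> \<bar>c\<bar> * ((Z \<theta> y)\<^sup>2 + Z \<theta> y ^ 4)"
          by (intro min.coboundedI2 mult_left_mono) auto
      qed simp
      also have "\<dots> = \<bar>c\<bar> * (v \<theta> + (\<integral>y. Z \<theta> y ^ 4 \<partial>P \<theta>))" by simp
      also have "\<dots> \<le> \<bar>c\<bar> * D"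
      proof (rule mult_left_mono)
        have "(\<theta> - a)\<^sup>2 \<le> 1\<^sup>2" using True \<delta> by (subst power2_abs[symmetric], intro power_mono) auto
        then have "A * (1 + (\<theta> - a)\<^sup>2) \<le> A * 2" using A by (intro mult_left_mono) auto
        moreover have "\<bar>\<theta>\<bar> ^ 4 \<le> (\<bar>a\<bar> + 1) ^ 4"
          using True \<delta> by (intro power_mono) auto
        then have "C * \<theta> ^ 4 \<le> C * (\<bar>a\<bar> + 1) ^ 4" using C_nonneg by (intro mult_left_mono) simp_all
        ultimately show "v \<theta> + (\<integral>y. Z \<theta> y ^ 4 \<partial>P \<theta>) \<le> D"
          using vA[OF \<theta>] fourth_bound[OF \<theta>] by (simp add: D_def)
      qed simp
      also have "\<dots> \<le> \<epsilon>" using hD(1)[of "\<bar>c\<bar>"] c by simp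
      also have "\<dots> \<le> \<epsilon> + 6 * K * (\<theta> - a)\<^sup>2" using K by simp
      finally show ?thesis .
    next
      case False
      have "?E \<le> (\<integral>y. 6 * (Z \<theta> y)\<^sup>2 \<partial>P \<theta>)"
        by (rule integral_mono[OF int]) auto
      then show ?thesis using far[OF \<theta> False] v_nonneg[OF a] \<epsilon> by simp
    qed
    have second: "\<bar>v \<theta> - v a\<bar> \<le> \<epsilon> + K * (\<theta> - a)\<^sup>2"
    proof (cases "\<bar>\<theta> - a\<bar> < \<delta>")
      case True
      moreover have "0 \<le> K * (\<theta> - a)\<^sup>2" using K by simp
      ultimately show ?thesis using d(2)[OF \<theta>] \<delta>(3) by force
    next
      case False
      then show ?thesis using far[OF \<theta> False] v_nonneg[OF a] v_nonneg[OF \<theta>] \<epsilon> by simp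
    qed
    have "(\<integral>y. iexp (c * Z \<theta> y) \<partial>P \<theta>) = char (distr (P \<theta>) borel (Z \<theta>)) c"
      unfolding char_def by (subst integral_distr) auto
    then have "cmod ((\<integral>y. iexp (c * Z \<theta> y) \<partial>P \<theta>) - (1 - c\<^sup>2 * v \<theta> / 2)) \<le> c\<^sup>2 / 6 * ?E"
      using P.char_approx3'[of "Z \<theta>" "v \<theta>" _ c] by simp
    also have "\<dots> \<le> c\<^sup>2 / 6 * (\<epsilon> + 6 * K * (\<theta> - a)\<^sup>2)"
      by (rule mult_left_mono[OF third]) simp
    finally have 1: "cmod ((\<integral>y. iexp (c * Z \<theta> y) \<partial>P \<theta>) - (1 - c\<^sup>2 * v \<theta> / 2))
      \<le> c\<^sup>2 / 6 * (\<epsilon> + 6 * K * (\<theta> - a)\<^sup>2)" .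
    let ?r = "(1 - c\<^sup>2 * v \<theta> / 2) - (1 - c\<^sup>2 * v a / 2)"
    have "?r = - (c\<^sup>2 / 2 * (v \<theta> - v a))" by (simp add: field_simps)
    then have "\<bar>?r\<bar> = c\<^sup>2 / 2 * \<bar>v \<theta> - v a\<bar>"
      by (simp only: abs_minus_cancel abs_mult) simp
    also have "\<dots> \<le> c\<^sup>2 / 2 * (\<epsilon> + K * (\<theta> - a)\<^sup>2)"
      by (rule mult_left_mono[OF second]) simp
    finally have 2: "\<bar>?r\<bar> \<le> c\<^sup>2 / 2 * (\<epsilon> + K * (\<theta> - a)\<^sup>2)" .
    let ?s = "(1 - c\<^sup>2 * v a / 2) - exp (- (c\<^sup>2 * v a / 2))"
    have "\<bar>?s\<bar> \<le> (c\<^sup>2 * v a / 2)\<^sup>2 / 2"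
      using exp_minus_second_order[of "c\<^sup>2 * v a / 2"] v_nonneg[OF a] by (simp add: abs_minus_commute)
    also have "\<dots> = c\<^sup>2 / 8 * (c\<^sup>2 * (v a)\<^sup>2)" by (simp add: power2_eq_square)
    also have "\<dots> \<le> c\<^sup>2 / 8 * \<epsilon>"
    proof (rule mult_left_mono)
      have "c\<^sup>2 = \<bar>c\<bar> * \<bar>c\<bar>" by (simp add: power2_eq_square)
      also have "\<dots> \<le> \<bar>c\<bar> * 1" using c h by (intro mult_left_mono) auto
      finally have "c\<^sup>2 * (v a)\<^sup>2 \<le> \<bar>c\<bar> * (v a)\<^sup>2" by (intro mult_right_mono) auto
      also have "\<dots> \<le> \<epsilon>" using hD(2)[of "\<bar>c\<bar>"] c by simp
      finally show "c\<^sup>2 * (v a)\<^sup>2 \<le> \<epsilon>" .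
    qed simp
    finally have 3: "\<bar>?s\<bar> \<le> c\<^sup>2 / 8 * \<epsilon>" .
    let ?I = "\<integral>y. iexp (c * Z \<theta> y) \<partial>P \<theta>"
    have tri: "cmod (x + (of_real r + of_real s)) \<le> cmod x + (\<bar>r\<bar> + \<bar>s\<bar>)" for x r s
      by (rule order_trans[OF norm_triangle_ineq], rule add_left_mono,
          rule order_trans[OF norm_triangle_ineq]) simp
    have "?I - exp (- (c\<^sup>2 * v a / 2)) =
        (?I - (1 - c\<^sup>2 * v \<theta> / 2)) + (of_real ?r + of_real ?s)" by simp
    then have "cmod (?I - exp (- (c\<^sup>2 * v a / 2))) \<le>
        cmod (?I - (1 - c\<^sup>2 * v \<theta> / 2)) + (\<bar>?r\<bar> + \<bar>?s\<bar>)"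
      using tri[of "?I - (1 - c\<^sup>2 * v \<theta> / 2)" ?r ?s] by (simp only:)
    also have "\<dots> \<le> c\<^sup>2 / 6 * (\<epsilon> + 6 * K * (\<theta> - a)\<^sup>2) + (c\<^sup>2 / 2 * (\<epsilon> + K * (\<theta> - a)\<^sup>2) + c\<^sup>2 / 8 * \<epsilon>)"
      by (intro add_mono 1 2 3)
    \<comment> \<open>The \<epsilon> terms add up to 1/6 + 1/2 + 1/8 = 19/24 and the
      \<open>K\<close> terms to 1 + 1/2 = 3/2, whence the witness \<open>2 * K\<close>.\<close>
    also have "\<dots> = c\<^sup>2 * (19 / 24 * \<epsilon> + 3 / 2 * (K * (\<theta> - a)\<^sup>2))" by (simp add: algebra_simps)
    also have "\<dots> \<le> c\<^sup>2 * (\<epsilon> + 2 * K * (\<theta> - a)\<^sup>2)"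
    proof -
      have "0 \<le> K * (\<theta> - a)\<^sup>2" using K by simp
      then have "19 / 24 * \<epsilon> + 3 / 2 * (K * (\<theta> - a)\<^sup>2) \<le> \<epsilon> + 2 * K * (\<theta> - a)\<^sup>2" using \<epsilon> by linarith
      then show ?thesis by (intro mult_left_mono) auto
    qed
    finally show ?thesis .
  qed
  show ?thesis
    using main h(1) K by (intro exI[of _ "2 * K"] exI[of _ h] conjI) auto
qed

end

section \<open>The recursion\<close>

text \<open>\<open>Y i\<close> is the observation drawn from \<open>P (T i w)\<close>, hence the one
  producing \<open>T (Suc i)\<close>. The relations hold at every point of the space, so that
  adaptedness and membership in \<open>\<Theta>\<close> need no exceptional sets.\<close>

locale adaptive_recursion = centered_family \<Theta> N P Z v + prob_space M
  for \<Theta> :: "real set" and N :: "'y measure" and P Z v and M :: "'w measure" +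
  fixes F :: "nat \<Rightarrow> 'w measure" and Y :: "nat \<Rightarrow> 'w \<Rightarrow> 'y" and T :: "nat \<Rightarrow> 'w \<Rightarrow> real"
    and b :: "nat \<Rightarrow> real" and t :: real
  assumes subalgebra_F: "\<And>i. subalgebra M (F i)"
    and F_mono: "\<And>i. sets (F i) \<subseteq> sets (F (Suc i))"
    and Y_measurable: "\<And>i. Y i \<in> M \<rightarrow>\<^sub>M N"
    and T_adapted: "\<And>i. T i \<in> borel_measurable (F i)"
    and T_in: "\<And>i w. w \<in> space M \<Longrightarrow> T i w \<in> \<Theta>"
    and T_0: "\<And>w. w \<in> space M \<Longrightarrow> T 0 w = t"
    and T_Suc: "\<And>i w. w \<in> space M \<Longrightarrow> T (Suc i) w = T i w + b i * Z (T i w) (Y i w)"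
    and conditional_law: "\<And>i A B. A \<in> sets (F i) \<Longrightarrow> B \<in> sets N \<Longrightarrow>
      emeasure M (A \<inter> Y i -` B) = (\<integral>\<^sup>+w. indicator A w * emeasure (P (T i w)) B \<partial>M)"
begin

lemma space_F_eq: "space (F i) = space M"
  using subalgebra_F[of i] by (simp add: subalgebra_def)

lemma T_measurable_restrict: "T i \<in> F i \<rightarrow>\<^sub>M restrict_space borel \<Theta>"
  using T_adapted[of i] T_in by (intro measurable_restrict_space2) (auto simp: space_F_eq)

lemma T_measurable [measurable]: "T i \<in> borel_measurable M"
  by (rule measurable_from_subalg[OF subalgebra_F T_adapted])

text \<open>By \<open>Z_variance\<close>, \<open>v\<close> is the integral of Z^2 against the kernel
  sending \<theta> to the law of (\<theta>, y) with y drawn from \<open>P \<theta>\<close>.\<close>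

lemma v_measurable_restrict: "v \<in> borel_measurable (restrict_space borel \<Theta>)"
proof -
  have "(\<lambda>\<theta>. \<integral>z. (case_prod Z z)\<^sup>2 \<partial>distr (P \<theta>) (restrict_space borel \<Theta> \<Otimes>\<^sub>M N) (Pair \<theta>))
      \<in> borel_measurable (restrict_space borel \<Theta>)"
    by (rule measurable_compose[OF measurable_prob_algebraD integral_measurable_subprob_algebra],
        rule measurable_distr_prob_space2[OF P_measurable]) measurable
  also have "?this \<longleftrightarrow> ?thesis"
  proof (rule measurable_cong)
    fix \<theta> assume \<theta>: "\<theta> \<in> space (restrict_space borel \<Theta>)"
    then have [measurable_cong]: "sets (P \<theta>) = sets N"
      using measurable_space[OF P_measurable] by (auto simp: space_prob_algebra)
    have "\<theta> \<in> \<Theta>" using \<theta> by (simp add: space_restrict_space)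
    with \<theta> show "(\<integral>z. (case_prod Z z)\<^sup>2 \<partial>distr (P \<theta>) (restrict_space borel \<Theta> \<Otimes>\<^sub>M N) (Pair \<theta>)) = v \<theta>"
      by (subst integral_distr) (auto simp: Z_variance)
  qed
  finally show ?thesis .
qed

lemma v_T_measurable [measurable]: "(\<lambda>w. v (T i w)) \<in> borel_measurable M"
  by (rule measurable_from_subalg[OF subalgebra_F measurable_compose[OF T_measurable_restrict v_measurable_restrict]])

lemma conditional_kernel: "conditional_kernel M (F i) N (Y i) (\<lambda>w. P (T i w))"
proof
  show "(\<lambda>w. P (T i w)) \<in> F i \<rightarrow>\<^sub>M prob_algebra N"
    by (rule measurable_compose[OF T_measurable_restrict P_measurable])
qed (fact subalgebra_F Y_measurable conditional_law)+

lemma Z_T_measurable: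
  "(\<lambda>(w, y). Z (T i w) y) \<in> borel_measurable (F i \<Otimes>\<^sub>M N)"
proof -
  have "(\<lambda>x. (T i (fst x), snd x)) \<in> F i \<Otimes>\<^sub>M N \<rightarrow>\<^sub>M restrict_space borel \<Theta> \<Otimes>\<^sub>M N"
    by (intro measurable_Pair measurable_compose[OF measurable_fst T_measurable_restrict] measurable_snd)
  from measurable_compose[OF this Z_measurable] show ?thesis
    by (simp add: case_prod_beta')
qed

section \<open>Second moments of the iterates and their almost sure convergence\<close>

lemma square_step:
  assumes h[measurable]: "h \<in> borel_measurable (F i)"
  shows "(\<integral>\<^sup>+w. ennreal ((h w + b i * Z (T i w) (Y i w))\<^sup>2) \<partial>M) =
    (\<integral>\<^sup>+w. ennreal ((h w)\<^sup>2 + (b i)\<^sup>2 * v (T i w)) \<partial>M)"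
proof -
  interpret conditional_kernel M "F i" N "Y i" "\<lambda>w. P (T i w)" by (rule conditional_kernel)
  have "(\<lambda>(w, y). ennreal ((h w + b i * Z (T i w) y)\<^sup>2)) \<in> borel_measurable (F i \<Otimes>\<^sub>M N)"
    using Z_T_measurable[of i] by (simp add: case_prod_beta')
  from nn_integral_kernel[OF this] show ?thesis
    by (simp add: nn_integral_shift_square T_in cong: nn_integral_cong)
qed

lemma F_le: "i \<le> j \<Longrightarrow> sets (F i) \<subseteq> sets (F j)"
  by (rule lift_Suc_mono_le[of "\<lambda>i. sets (F i)"]) (rule F_mono)

lemma T_adapted_le: "i \<le> j \<Longrightarrow> T i \<in> borel_measurable (F j)"
  using T_adapted[of i] F_le[of i j] by (auto simp: measurable_def space_F_eq)

text \<open>The martingale increment is orthogonal to everything known at step \<open>i\<close>. A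
  constant \<open>h\<close> yields the second moments, and \<open>h = T k\<close> yields the
  increments from \<open>k\<close> on.\<close>

lemma square_Suc:
  assumes h[measurable]: "h \<in> borel_measurable (F i)"
  shows "(\<integral>\<^sup>+w. ennreal ((T (Suc i) w - h w)\<^sup>2) \<partial>M) =
    (\<integral>\<^sup>+w. ennreal ((T i w - h w)\<^sup>2 + (b i)\<^sup>2 * v (T i w)) \<partial>M)"
proof -
  have "(\<integral>\<^sup>+w. ennreal ((T (Suc i) w - h w)\<^sup>2) \<partial>M) =
    (\<integral>\<^sup>+w. ennreal (((T i w - h w) + b i * Z (T i w) (Y i w))\<^sup>2) \<partial>M)"
    by (intro nn_integral_cong) (simp add: T_Suc algebra_simps)
  also have "\<dots> = (\<integral>\<^sup>+w. ennreal ((T i w - h w)\<^sup>2 + (b i)\<^sup>2 * v (T i w)) \<partial>M)"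
    by (rule square_step) (use T_adapted h in measurable)
  finally show ?thesis .
qed

context
  fixes A a :: real
  assumes A: "0 \<le> A" and growth: "\<And>\<theta>. \<theta> \<in> \<Theta> \<Longrightarrow> v \<theta> \<le> A * (1 + (\<theta> - a)\<^sup>2)"
begin

text \<open>A discrete Gronwall argument: the growth bound multiplies the moment by at most 1 + A
  b^2 \<le> exp(A b^2) per step. Square integrability is a result of this bound and not an
  input.\<close>

lemma moment_bound_nn:
  "(\<integral>\<^sup>+w. ennreal (1 + (T i w - a)\<^sup>2) \<partial>M) \<le> ennreal ((1 + (t - a)\<^sup>2) * exp (A * (\<Sum>j<i. (b j)\<^sup>2)))"
proof (induction i)
  case 0
  have "(\<integral>\<^sup>+w. ennreal (1 + (T 0 w - a)\<^sup>2) \<partial>M) = (\<integral>\<^sup>+w. ennreal (1 + (t - a)\<^sup>2) \<partial>M)"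
    by (intro nn_integral_cong) (simp add: T_0)
  then show ?case by (simp add: emeasure_space_1)
next
  case (Suc i)
  have "(\<integral>\<^sup>+w. ennreal (1 + (T (Suc i) w - a)\<^sup>2) \<partial>M) = 1 + (\<integral>\<^sup>+w. ennreal ((T (Suc i) w - a)\<^sup>2) \<partial>M)"
    by (simp add: nn_integral_add emeasure_space_1)
  also have "\<dots> = 1 + (\<integral>\<^sup>+w. ennreal ((T i w - a)\<^sup>2 + (b i)\<^sup>2 * v (T i w)) \<partial>M)"
    by (subst square_Suc) auto
  also have "\<dots> = (\<integral>\<^sup>+w. 1 + ennreal ((T i w - a)\<^sup>2 + (b i)\<^sup>2 * v (T i w)) \<partial>M)"
    by (subst nn_integral_add) (auto simp: emeasure_space_1)
  also have "\<dots> \<le> (\<integral>\<^sup>+w. ennreal (1 + A * (b i)\<^sup>2) * ennreal (1 + (T i w - a)\<^sup>2) \<partial>M)"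
  proof (rule nn_integral_mono)
    fix w assume w: "w \<in> space M"
    have "(b i)\<^sup>2 * v (T i w) \<le> (b i)\<^sup>2 * (A * (1 + (T i w - a)\<^sup>2))"
      by (rule mult_left_mono[OF growth[OF T_in[OF w]]]) simp
    then have "1 + ((T i w - a)\<^sup>2 + (b i)\<^sup>2 * v (T i w)) \<le> (1 + A * (b i)\<^sup>2) * (1 + (T i w - a)\<^sup>2)"
      by (simp add: algebra_simps)
    moreover have "0 \<le> v (T i w)" by (rule v_nonneg[OF T_in[OF w]])
    ultimately show "1 + ennreal ((T i w - a)\<^sup>2 + (b i)\<^sup>2 * v (T i w)) \<le>
        ennreal (1 + A * (b i)\<^sup>2) * ennreal (1 + (T i w - a)\<^sup>2)"
      using A by (simp add: ennreal_mult[symmetric] ennreal_plus[symmetric] ennreal_1[symmetric]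
          del: ennreal_plus ennreal_1)
  qed
  also have "\<dots> = ennreal (1 + A * (b i)\<^sup>2) * (\<integral>\<^sup>+w. ennreal (1 + (T i w - a)\<^sup>2) \<partial>M)"
    by (rule nn_integral_cmult) measurable
  also have "\<dots> \<le> ennreal (exp (A * (b i)\<^sup>2)) * ennreal ((1 + (t - a)\<^sup>2) * exp (A * (\<Sum>j<i. (b j)\<^sup>2)))"
    by (intro mult_mono Suc.IH ennreal_leI exp_ge_add_one_self) auto
  also have "\<dots> = ennreal ((1 + (t - a)\<^sup>2) * exp (A * (\<Sum>j<Suc i. (b j)\<^sup>2)))"
    by (simp add: ennreal_mult[symmetric] exp_add distrib_left mult_ac)
  finally show ?case .
qed

context
  fixes S :: real
  assumes S: "\<And>i. (\<Sum>j<i. (b j)\<^sup>2) \<le> S"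
begin

lemma moment_bound_uniform:
  "(\<integral>\<^sup>+w. ennreal (1 + (T i w - a)\<^sup>2) \<partial>M) \<le> ennreal ((1 + (t - a)\<^sup>2) * exp (A * S))"
  using moment_bound_nn[of i] S[of i] A
  by (elim order_trans) (intro ennreal_leI mult_left_mono, auto intro!: mult_left_mono)

lemma square_integrable_T: "integrable M (\<lambda>w. (T i w - a)\<^sup>2)"
proof -
  have "(\<integral>\<^sup>+w. ennreal ((T i w - a)\<^sup>2) \<partial>M) \<le> (\<integral>\<^sup>+w. ennreal (1 + (T i w - a)\<^sup>2) \<partial>M)"
    by (intro nn_integral_mono ennreal_leI) simp
  also note moment_bound_uniform
  finally have "(\<integral>\<^sup>+w. ennreal ((T i w - a)\<^sup>2) \<partial>M) < \<infinity>"
    by (simp add: le_less_trans)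
  then show ?thesis by (intro integrableI_bounded) auto
qed

text \<open>The right side vanishes as \<open>t\<close> tends to \<open>a\<close> and
  \<open>S\<close> to 0, which makes the error from the displacement of the iterates
  negligible.\<close>

lemma second_moment_le: "(\<integral>w. (T i w - a)\<^sup>2 \<partial>M) \<le> (1 + (t - a)\<^sup>2) * exp (A * S) - 1"
proof -
  have "ennreal (\<integral>w. 1 + (T i w - a)\<^sup>2 \<partial>M) = (\<integral>\<^sup>+w. ennreal (1 + (T i w - a)\<^sup>2) \<partial>M)"
    by (rule nn_integral_eq_integral[symmetric]) (auto simp: square_integrable_T)
  also note moment_bound_uniform
  finally have "(\<integral>w. 1 + (T i w - a)\<^sup>2 \<partial>M) \<le> (1 + (t - a)\<^sup>2) * exp (A * S)"
    by (simp add: ennreal_le_iff)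
  then show ?thesis by (simp add: square_integrable_T prob_space)
qed

text \<open>\<open>square_Suc\<close> with \<open>h = T k\<close> adds one conditional variance per
  step, and the uniform moment bound controls its mean.\<close>

lemma increment_bound:
  "(\<integral>\<^sup>+w. ennreal ((T (k + m) w - T k w)\<^sup>2) \<partial>M) \<le>
    ennreal (A * ((1 + (t - a)\<^sup>2) * exp (A * S)) * (\<Sum>j<m. (b (k + j))\<^sup>2))"
proof (induction m)
  case (Suc m)
  let ?Q = "(1 + (t - a)\<^sup>2) * exp (A * S)"
  have "(\<integral>\<^sup>+w. ennreal ((T (k + Suc m) w - T k w)\<^sup>2) \<partial>M) =
      (\<integral>\<^sup>+w. ennreal ((T (k + m) w - T k w)\<^sup>2 + (b (k + m))\<^sup>2 * v (T (k + m) w)) \<partial>M)"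
    using square_Suc[OF T_adapted_le[of k "k + m"]] by simp
  also have "\<dots> \<le> (\<integral>\<^sup>+w. ennreal ((T (k + m) w - T k w)\<^sup>2)
      + ennreal ((b (k + m))\<^sup>2 * A) * ennreal (1 + (T (k + m) w - a)\<^sup>2) \<partial>M)"
  proof (rule nn_integral_mono)
    fix w assume w: "w \<in> space M"
    have "(b (k + m))\<^sup>2 * v (T (k + m) w) \<le> (b (k + m))\<^sup>2 * (A * (1 + (T (k + m) w - a)\<^sup>2))"
      by (rule mult_left_mono[OF growth[OF T_in[OF w]]]) simp
    then show "ennreal ((T (k + m) w - T k w)\<^sup>2 + (b (k + m))\<^sup>2 * v (T (k + m) w)) \<le>
        ennreal ((T (k + m) w - T k w)\<^sup>2) + ennreal ((b (k + m))\<^sup>2 * A) * ennreal (1 + (T (k + m) w - a)\<^sup>2)"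
      using A by (simp add: ennreal_mult[symmetric] ennreal_plus[symmetric] mult.assoc
          del: ennreal_plus)
  qed
  also have "\<dots> = (\<integral>\<^sup>+w. ennreal ((T (k + m) w - T k w)\<^sup>2) \<partial>M)
      + ennreal ((b (k + m))\<^sup>2 * A) * (\<integral>\<^sup>+w. ennreal (1 + (T (k + m) w - a)\<^sup>2) \<partial>M)"
    by (simp add: nn_integral_add nn_integral_cmult del: ennreal_plus)
  also have "\<dots> \<le> ennreal (A * ?Q * (\<Sum>j<m. (b (k + j))\<^sup>2)) + ennreal ((b (k + m))\<^sup>2 * A) * ennreal ?Q"
    by (intro add_mono mult_left_mono Suc.IH moment_bound_uniform) auto
  also have "\<dots> = ennreal (A * ?Q * (\<Sum>j<m. (b (k + j))\<^sup>2) + (b (k + m))\<^sup>2 * A * ?Q)"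
    using A by (simp add: ennreal_mult[symmetric] ennreal_plus[symmetric] sum_nonneg del: ennreal_plus)
  also have "A * ?Q * (\<Sum>j<m. (b (k + j))\<^sup>2) + (b (k + m))\<^sup>2 * A * ?Q = A * ?Q * (\<Sum>j<Suc m. (b (k + j))\<^sup>2)"
    by (simp add: algebra_simps)
  finally show ?case .
qed simp

text \<open>The weights are at most 1/j, so the squared weights from \<open>k\<close> to
  \<open>m\<close> sum to at most (m - k) / k^2, the form required by
  \<open>AE_convergent_of_quadratic_increments\<close>.\<close>

lemma AE_convergent_T:
  assumes b: "\<And>j. 1 \<le> j \<Longrightarrow> \<bar>b j\<bar> \<le> 1 / real j"
  shows "AE w in M. convergent (\<lambda>i. T i w)"
proof (rule AE_convergent_of_quadratic_increments[OF T_measurable])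
  let ?Q = "A * ((1 + (t - a)\<^sup>2) * exp (A * S))"
  show Q: "0 \<le> ?Q" using A by simp
  fix k m :: nat assume k: "1 \<le> k" "k \<le> m"
  have "(\<Sum>j<m - k. (b (k + j))\<^sup>2) \<le> (\<Sum>j<m - k. 1 / (real k)\<^sup>2)"
  proof (rule sum_mono)
    fix j
    have "\<bar>b (k + j)\<bar> \<le> 1 / real (k + j)" by (rule b) (use k in simp)
    also have "\<dots> \<le> 1 / real k" using k by (simp add: frac_le)
    finally have "\<bar>b (k + j)\<bar>\<^sup>2 \<le> (1 / real k)\<^sup>2" by (rule power_mono) simp
    then show "(b (k + j))\<^sup>2 \<le> 1 / (real k)\<^sup>2" by (simp add: power_divide)
  qed
  then have "?Q * (\<Sum>j<m - k. (b (k + j))\<^sup>2) \<le> ?Q * ((real m - real k) / (real k)\<^sup>2)"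
    using Q k by (intro mult_left_mono) (auto simp: of_nat_diff)
  then show "(\<integral>\<^sup>+w. ennreal ((T m w - T k w)\<^sup>2) \<partial>M) \<le> ennreal (?Q * (real m - real k) / (real k)\<^sup>2)"
    using increment_bound[of k "m - k"] k
    by (auto intro: order_trans ennreal_leI)
qed

end

end

section \<open>Comparison of characteristic functions along the recursion\<close>

text \<open>Conditioning on the past splits off the characteristic function of the next increment at
  the current iterate. Replacing it by the Gaussian factor costs the bound in \<open>step\<close>,
  averaged over the iterate, and the previous error is carried along without growing.\<close>

lemma char_telescope:
  assumes \<sigma>: "0 \<le> \<sigma>" and \<epsilon>: "0 \<le> \<epsilon>" and K: "0 \<le> K"
    and step: "\<And>\<theta> i. \<theta> \<in> \<Theta> \<Longrightarrow>
      cmod ((\<integral>y. iexp (u * b i * Z \<theta> y) \<partial>P \<theta>) - exp (- ((u * b i)\<^sup>2 * \<sigma> / 2))) \<le> (u * b i)\<^sup>2 * (\<epsilon> + K * (\<theta> - a)\<^sup>2)"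
    and integrable: "\<And>i. integrable M (\<lambda>w. (T i w - a)\<^sup>2)"
    and moment: "\<And>i. (\<integral>w. (T i w - a)\<^sup>2 \<partial>M) \<le> X"
  shows "cmod ((\<integral>w. iexp (u * (T i w - t)) \<partial>M) - exp (- ((\<Sum>j<i. (u * b j)\<^sup>2) * \<sigma> / 2)))
    \<le> (\<Sum>j<i. (u * b j)\<^sup>2) * (\<epsilon> + K * X)"
proof (induction i)
  case 0
  have "(\<integral>w. iexp (u * (T 0 w - t)) \<partial>M) = (\<integral>w. 1 \<partial>M)"
    by (intro Bochner_Integration.integral_cong) (auto simp: T_0)
  then show ?case by (simp add: prob_space)
next
  case (Suc i)
  interpret K: conditional_kernel M "F i" N "Y i" "\<lambda>w. P (T i w)" by (rule conditional_kernel)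
  define c where "c = u * b i"
  define e where "e = exp (- (c\<^sup>2 * \<sigma> / 2))"
  define \<phi> where "\<phi> w = (\<integral>y. iexp (c * Z (T i w) y) \<partial>P (T i w))" for w
  let ?E = "\<lambda>w. iexp (u * (T i w - t))"
  have [measurable]: "T i \<in> borel_measurable (F i)" by (rule T_adapted)
  have mZ: "(\<lambda>x. Z (T i (fst x)) (snd x)) \<in> borel_measurable (F i \<Otimes>\<^sub>M N)"
    using Z_T_measurable[of i] by (simp add: case_prod_beta')
  have m1: "(\<lambda>(w, y). ?E w * iexp (c * Z (T i w) y)) \<in> borel_measurable (F i \<Otimes>\<^sub>M N)"
    unfolding case_prod_beta' using mZ by measurable
  have m2: "(\<lambda>(w, y). iexp (c * Z (T i w) y)) \<in> borel_measurable (F i \<Otimes>\<^sub>M N)"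
    unfolding case_prod_beta' using mZ by measurable
  have \<phi>m [measurable]: "\<phi> \<in> borel_measurable M"
    unfolding \<phi>_def by (rule K.measurable_F[OF K.kernel_integral_measurable[OF m2]])
  have \<phi>1: "cmod (\<phi> w) \<le> 1" if "w \<in> space M" for w
    unfolding \<phi>_def by (rule K.norm_integral_kernel_le[OF that]) simp
  have Ei [simp]: "integrable M ?E"
    by (rule integrable_const_bound[where B=1]) auto
  have E\<phi>i [simp]: "integrable M (\<lambda>w. ?E w * \<phi> w)"
    by (rule integrable_const_bound[where B=1]) (auto simp: norm_mult \<phi>1)
  have "(\<integral>w. iexp (u * (T (Suc i) w - t)) \<partial>M) = (\<integral>w. ?E w * iexp (c * Z (T i w) (Y i w)) \<partial>M)"
  proof (rule Bochner_Integration.integral_cong[OF refl])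
    fix w assume w: "w \<in> space M"
    show "iexp (u * (T (Suc i) w - t)) = ?E w * iexp (c * Z (T i w) (Y i w))"
      by (simp add: T_Suc[OF w] c_def exp_add[symmetric] algebra_simps)
  qed
  also have "\<dots> = (\<integral>w. (\<integral>y. ?E w * iexp (c * Z (T i w) y) \<partial>P (T i w)) \<partial>M)"
    by (rule K.integral_kernel_complex[OF m1, where c=1]) (simp add: norm_mult)
  also have "\<dots> = (\<integral>w. ?E w * \<phi> w \<partial>M)"
    by (simp add: \<phi>_def)
  finally have E': "(\<integral>w. iexp (u * (T (Suc i) w - t)) \<partial>M) = (\<integral>w. ?E w * \<phi> w \<partial>M)" .
  have "(\<integral>w. f w * (g w - z) \<partial>M) = (\<integral>w. f w * g w \<partial>M) - z * (\<integral>w. f w \<partial>M)"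
    if "integrable M f" "integrable M (\<lambda>w. f w * g w)" for f g :: "'w \<Rightarrow> complex" and z
    using that by (simp add: right_diff_distrib mult.commute[of _ z])
  from this[OF Ei E\<phi>i] have "cmod ((\<integral>w. ?E w * \<phi> w \<partial>M) - e * (\<integral>w. ?E w \<partial>M)) = cmod (\<integral>w. ?E w * (\<phi> w - e) \<partial>M)"
    by simp
  also have "\<dots> \<le> (\<integral>w. c\<^sup>2 * (\<epsilon> + K * (T i w - a)\<^sup>2) \<partial>M)"
  proof (rule order_trans[OF integral_norm_bound], rule integral_mono, rule integrable_norm)
    show "integrable M (\<lambda>w. ?E w * (\<phi> w - e))"
      using E\<phi>i Ei by (simp add: right_diff_distrib)
    show "integrable M (\<lambda>w. c\<^sup>2 * (\<epsilon> + K * (T i w - a)\<^sup>2))" using integrable by simp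
    fix w assume w: "w \<in> space M"
    show "norm (?E w * (\<phi> w - e)) \<le> c\<^sup>2 * (\<epsilon> + K * (T i w - a)\<^sup>2)"
      using step[OF T_in[OF w], of i i] by (simp add: norm_mult \<phi>_def e_def c_def)
  qed
  also have "\<dots> = c\<^sup>2 * (\<epsilon> + K * (\<integral>w. (T i w - a)\<^sup>2 \<partial>M))"
    using integrable by (simp add: prob_space)
  also have "\<dots> \<le> c\<^sup>2 * (\<epsilon> + K * X)"
    using moment[of i] K by (intro mult_left_mono add_left_mono) auto
  finally have 1: "cmod ((\<integral>w. ?E w * \<phi> w \<partial>M) - e * (\<integral>w. ?E w \<partial>M)) \<le> c\<^sup>2 * (\<epsilon> + K * X)" .
  let ?g = "exp (- ((\<Sum>j<i. (u * b j)\<^sup>2) * \<sigma> / 2))"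
  \<comment> \<open>The Gaussian factor \<open>e\<close> is at most 1 because \<sigma> is
    non-negative, so the inherited error is not amplified.\<close>
  have "cmod (e * (\<integral>w. ?E w \<partial>M) - e * ?g) = e * cmod ((\<integral>w. ?E w \<partial>M) - ?g)"
    by (simp add: right_diff_distrib[symmetric] norm_mult e_def)
  also have "\<dots> \<le> 1 * cmod ((\<integral>w. ?E w \<partial>M) - ?g)"
    using \<sigma> by (intro mult_right_mono) (auto simp: e_def)
  also have "\<dots> \<le> (\<Sum>j<i. (u * b j)\<^sup>2) * (\<epsilon> + K * X)"
    using Suc.IH by simp
  finally have 2: "cmod (e * (\<integral>w. ?E w \<partial>M) - e * ?g) \<le> (\<Sum>j<i. (u * b j)\<^sup>2) * (\<epsilon> + K * X)" .
  have g: "exp (- ((\<Sum>j<Suc i. (u * b j)\<^sup>2) * \<sigma> / 2)) = e * ?g"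
    by (simp add: e_def c_def exp_add[symmetric] add_divide_distrib distrib_right)
  have "cmod ((\<integral>w. ?E w * \<phi> w \<partial>M) - e * ?g) \<le> c\<^sup>2 * (\<epsilon> + K * X) + (\<Sum>j<i. (u * b j)\<^sup>2) * (\<epsilon> + K * X)"
    by (rule norm_diff_triangle_le[OF 1 2])
  also have "\<dots> = (\<Sum>j<Suc i. (u * b j)\<^sup>2) * (\<epsilon> + K * X)"
    by (simp add: c_def algebra_simps)
  finally show ?case unfolding E' g by simp
qed

end

text \<open>The bound of \<open>char_telescope\<close> is stable under i \<rightarrow> \<infinity>:
  the exponentials are unimodular, so dominated convergence carries the almost sure limit into the
  integral.\<close>

lemma (in adaptive_recursion) char_limit:
  assumes \<sigma>: "0 \<le> \<sigma>" and \<epsilon>: "0 \<le> \<epsilon>" and K: "0 \<le> K"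
    and step: "\<And>\<theta> i. \<theta> \<in> \<Theta> \<Longrightarrow>
      cmod ((\<integral>y. iexp (u * b i * Z \<theta> y) \<partial>P \<theta>) - exp (- ((u * b i)\<^sup>2 * \<sigma> / 2))) \<le> (u * b i)\<^sup>2 * (\<epsilon> + K * (\<theta> - a)\<^sup>2)"
    and integrable: "\<And>i. integrable M (\<lambda>w. (T i w - a)\<^sup>2)"
    and moment: "\<And>i. (\<integral>w. (T i w - a)\<^sup>2 \<partial>M) \<le> X"
    and conv: "AE w in M. convergent (\<lambda>i. T i w)"
    and sums: "(\<lambda>j. (b j)\<^sup>2) sums R"
  shows "cmod ((\<integral>w. iexp (u * (lim (\<lambda>i. T i w) - t)) \<partial>M) - exp (- (u\<^sup>2 * R * \<sigma> / 2)))
    \<le> u\<^sup>2 * R * (\<epsilon> + K * X)"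
proof -
  have S: "(\<lambda>i. \<Sum>j<i. (u * b j)\<^sup>2) \<longlonglongrightarrow> u\<^sup>2 * R"
    using sums_mult[OF sums, of "u\<^sup>2"] by (simp add: sums_def power_mult_distrib)
  have "(\<lambda>i. \<integral>w. iexp (u * (T i w - t)) \<partial>M) \<longlonglongrightarrow> (\<integral>w. iexp (u * (lim (\<lambda>i. T i w) - t)) \<partial>M)"
  proof (rule integral_dominated_convergence[where w="\<lambda>_. 1"])
    show "AE w in M. (\<lambda>i. iexp (u * (T i w - t))) \<longlonglongrightarrow> iexp (u * (lim (\<lambda>i. T i w) - t))"
      using conv
    proof eventually_elim
      case (elim w)
      then show ?case by (intro tendsto_intros) (simp add: convergent_LIMSEQ_iff)
    qed
  qed auto
  then have "(\<lambda>i. cmod ((\<integral>w. iexp (u * (T i w - t)) \<partial>M) - of_real (exp (- ((\<Sum>j<i. (u * b j)\<^sup>2) * \<sigma> / 2)))))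
    \<longlonglongrightarrow> cmod ((\<integral>w. iexp (u * (lim (\<lambda>i. T i w) - t)) \<partial>M) - of_real (exp (- (u\<^sup>2 * R * \<sigma> / 2))))"
    by (intro tendsto_intros S) simp_all
  moreover have "(\<lambda>i. (\<Sum>j<i. (u * b j)\<^sup>2) * (\<epsilon> + K * X)) \<longlonglongrightarrow> u\<^sup>2 * R * (\<epsilon> + K * X)"
    by (intro tendsto_intros S)
  ultimately show ?thesis
    by (rule LIMSEQ_le) (use char_telescope[OF \<sigma> \<epsilon> K step integrable moment] in blast)
qed

section \<open>From the posterior scheme to the recursion\<close>

lemma space_past: "space (past \<mu> W Ys i) = space W"
  by (simp add: past_def)

lemma past_map_measurable:
  assumes "\<And>j. j \<ge> 1 \<Longrightarrow> Ys j \<in> W \<rightarrow>\<^sub>M \<mu>"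
  shows "(\<lambda>w. \<lambda>j\<in>{1..i}. Ys j w) \<in> W \<rightarrow>\<^sub>M Pi\<^sub>M {1..i} (\<lambda>_. \<mu>)"
  by (rule measurable_restrict) (simp add: assms)

lemma subalgebra_past:
  assumes "\<And>j. j \<ge> 1 \<Longrightarrow> Ys j \<in> W \<rightarrow>\<^sub>M \<mu>"
  shows "subalgebra W (past \<mu> W Ys i)"
  unfolding subalgebra_def past_def
  by (auto intro!: sets_image_in_sets[OF refl past_map_measurable[OF assms], THEN subsetD])

lemma past_component_measurable:
  assumes "\<And>j. j \<ge> 1 \<Longrightarrow> Ys j \<in> W \<rightarrow>\<^sub>M \<mu>" and j: "j \<in> {1..i}"
  shows "Ys j \<in> past \<mu> W Ys i \<rightarrow>\<^sub>M \<mu>"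
proof -
  have "(\<lambda>w. \<lambda>j\<in>{1..i}. Ys j w) \<in> past \<mu> W Ys i \<rightarrow>\<^sub>M Pi\<^sub>M {1..i} (\<lambda>_. \<mu>)"
    unfolding past_def
    by (rule measurable_vimage_algebra1) (rule measurable_space[OF past_map_measurable[OF assms(1)], THEN Pi_I])
  from measurable_compose[OF this measurable_component_singleton[OF j]] show ?thesis
    using j by simp
qed

lemma past_mono:
  assumes Ys: "\<And>j. j \<ge> 1 \<Longrightarrow> Ys j \<in> W \<rightarrow>\<^sub>M \<mu>"
  shows "sets (past \<mu> W Ys i) \<subseteq> sets (past \<mu> W Ys (Suc i))"
proof -
  have "(\<lambda>w. \<lambda>j\<in>{1..i}. Ys j w) \<in> past \<mu> W Ys (Suc i) \<rightarrow>\<^sub>M Pi\<^sub>M {1..i} (\<lambda>_. \<mu>)"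
    by (rule measurable_restrict) (rule past_component_measurable[OF Ys], auto)
  then show ?thesis
    unfolding past_def[of \<mu> W Ys i] by (intro sets_image_in_sets) (simp_all add: space_past)
qed

lemma sets_past:
  assumes "\<And>j. j \<ge> 1 \<Longrightarrow> Ys j \<in> W \<rightarrow>\<^sub>M \<mu>"
  shows "sets (past \<mu> W Ys i) =
    {(\<lambda>w. \<lambda>j\<in>{1..i}. Ys j w) -` X \<inter> space W | X. X \<in> sets (Pi\<^sub>M {1..i} (\<lambda>_. \<mu>))}"
  unfolding past_def
  by (rule sets_vimage_algebra2) (rule measurable_space[OF past_map_measurable[OF assms], THEN Pi_I])

text \<open>Composition with a retraction \<open>\<rho>\<close> of the space onto a set of full measure makes the almost sure
  hypotheses hold everywhere. The iterates are then honestly adapted, and \<open>\<Theta>\<close>, which need not be a Borel set,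
  can serve as their range.\<close>

lemma (in centered_family) adaptive_recursion_of_AE:
  assumes W: "prob_space W"
    and Ys: "\<And>j. j \<ge> 1 \<Longrightarrow> Ys j \<in> W \<rightarrow>\<^sub>M N"
    and T: "\<And>i. T i \<in> borel_measurable W"
    and T0: "AE w in W. T 0 w = t"
    and law: "\<And>i A. A \<in> sets N \<Longrightarrow> AE w in W.
        real_cond_exp W (past N W Ys i) (\<lambda>w. indicator A (Ys (Suc i) w)) w = measure (P (T i w)) A"
    and TS: "\<And>i. AE w in W. T (Suc i) w = T i w + b i * Z (T i w) (Ys (Suc i) w)"
    and Tin: "\<And>i. AE w in W. T i w \<in> \<Theta>"
  obtains F Y T' where "adaptive_recursion \<Theta> N P Z v W F Y T' b t" "AE w in W. \<forall>i. T' i w = T i w"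
proof -
  interpret prob_space W by (rule W)
  let ?G = "\<lambda>w. T 0 w = t \<and> (\<forall>i. T (Suc i) w = T i w + b i * Z (T i w) (Ys (Suc i) w)) \<and> (\<forall>i. T i w \<in> \<Theta>)"
  have "AE w in W. ?G w" using T0 TS Tin by (simp add: AE_all_countable)
  then obtain N0 where N0: "{w\<in>space W. \<not> ?G w} \<subseteq> N0" "emeasure W N0 = 0" "N0 \<in> sets W"
    by (rule AE_E)
  have aeN0: "AE w in W. w \<notin> N0" by (rule AE_not_in) (simp add: N0 null_setsI)
  \<comment> \<open>A set of full measure is non-empty; any of its points can serve as the image of
    the exceptional set under the retraction.\<close>
  have "space W - N0 \<noteq> {}"
  proof
    assume empty: "space W - N0 = {}"
    have "AE w in W. False" using aeN0 AE_space by eventually_elim (use empty in auto)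
    then show False by simp
  qed
  then obtain w0 where w0: "w0 \<in> space W" "w0 \<notin> N0" by auto
  define \<rho> where "\<rho> w = (if w \<in> N0 then w0 else w)" for w
  have \<rho>m [measurable]: "\<rho> \<in> W \<rightarrow>\<^sub>M W"
    unfolding \<rho>_def[abs_def] using N0(3) w0 by (intro measurable_If_set) auto
  have \<rho>G: "?G (\<rho> w)" "\<rho> w \<in> space W" if "w \<in> space W" for w
    using N0(1) w0 that by (auto simp: \<rho>_def)
  have ae\<rho>: "AE w in W. \<rho> w = w" using aeN0 by eventually_elim (simp add: \<rho>_def)
  define Y' where "Y' j w = Ys j (\<rho> w)" for j w
  define T' where "T' i w = T i (\<rho> w)" for i w
  have Y'm: "Y' j \<in> W \<rightarrow>\<^sub>M N" if "j \<ge> 1" for j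
    unfolding Y'_def[abs_def] by (rule measurable_compose[OF \<rho>m Ys[OF that]])
  let ?F = "past N W Y'"
  have sub: "subalgebra W (?F i)" for i by (rule subalgebra_past) (rule Y'm)
  have T'in: "T' i w \<in> \<Theta>" if "w \<in> space W" for i w
    using \<rho>G[OF that] by (simp add: T'_def)
  have T'S: "T' (Suc i) w = T' i w + b i * Z (T' i w) (Y' (Suc i) w)" if "w \<in> space W" for i w
    using \<rho>G[OF that] by (simp add: T'_def Y'_def)
  have T'0: "T' 0 w = t" if "w \<in> space W" for w
    using \<rho>G[OF that] by (simp add: T'_def)
  \<comment> \<open>After the modification \<open>T' (Suc i)\<close> is exactly a measurable
    function of \<open>T' i\<close> and \<open>Y' (Suc i)\<close>, so induction applies. The given
    iterates have this form only up to null sets.\<close>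
  have adapted: "T' i \<in> borel_measurable (?F i)" for i
  proof (induction i)
    case 0
    have "T' 0 \<in> borel_measurable (?F 0) \<longleftrightarrow> (\<lambda>_. t) \<in> borel_measurable (?F 0)"
      by (rule measurable_cong) (simp add: space_past T'0)
    then show ?case by simp
  next
    case (Suc i)
    have "subalgebra (?F (Suc i)) (?F i)"
      unfolding subalgebra_def space_past by (intro conjI refl past_mono) (rule Y'm)
    then have T1 [measurable]: "T' i \<in> borel_measurable (?F (Suc i))"
      using Suc by (rule measurable_from_subalg)
    have T2: "T' i \<in> ?F (Suc i) \<rightarrow>\<^sub>M restrict_space borel \<Theta>"
      by (rule measurable_restrict_space2[OF _ T1]) (auto simp: space_past T'in)
    have Y2: "Y' (Suc i) \<in> ?F (Suc i) \<rightarrow>\<^sub>M N"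
      by (rule past_component_measurable) (auto intro: Y'm)
    have [measurable]: "(\<lambda>w. Z (T' i w) (Y' (Suc i) w)) \<in> borel_measurable (?F (Suc i))"
      using measurable_compose[OF measurable_Pair[OF T2 Y2] Z_measurable] by simp
    have "T' (Suc i) \<in> borel_measurable (?F (Suc i)) \<longleftrightarrow>
        (\<lambda>w. T' i w + b i * Z (T' i w) (Y' (Suc i) w)) \<in> borel_measurable (?F (Suc i))"
      by (rule measurable_cong) (simp add: space_past T'S)
    then show ?case by simp
  qed
  have T'm: "T' i \<in> W \<rightarrow>\<^sub>M restrict_space borel \<Theta>" for i
    by (rule measurable_restrict_space2[OF _ measurable_from_subalg[OF sub adapted]]) (simp add: T'in)
  have cond: "emeasure W (A \<inter> Y' (Suc i) -` B) = (\<integral>\<^sup>+w. indicator A w * emeasure (P (T' i w)) B \<partial>W)"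
    if A: "A \<in> sets (?F i)" and B: "B \<in> sets N" for i A B
  proof -
    obtain X where X: "X \<in> sets (Pi\<^sub>M {1..i} (\<lambda>_. N))"
      and AX: "A = (\<lambda>w. \<lambda>j\<in>{1..i}. Y' j w) -` X \<inter> space W"
      using A by (subst (asm) sets_past) (auto intro: Y'm)
    \<comment> \<open>\<open>A1\<close> is the event with the same \<open>X\<close> for the original
      observations. It lies in the sigma-algebra to which the conditional law refers, and it differs
      from \<open>A\<close> by a null set only.\<close>
    define A1 where "A1 = (\<lambda>w. \<lambda>j\<in>{1..i}. Ys j w) -` X \<inter> space W"
    have A1: "A1 \<in> sets (past N W Ys i)"
      by (subst sets_past) (use Ys X in \<open>auto simp: A1_def\<close>)
    have subS: "subalgebra W (past N W Ys i)" by (rule subalgebra_past) (rule Ys)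
    have A1W [measurable]: "A1 \<in> sets W"
      using A1 subS by (auto simp: subalgebra_def)
    have AW [measurable]: "A \<in> sets W"
      using A sub[of i] by (auto simp: subalgebra_def)
    have [measurable]: "Ys (Suc i) \<in> W \<rightarrow>\<^sub>M N" "Y' (Suc i) \<in> W \<rightarrow>\<^sub>M N" "B \<in> sets N"
      using Ys Y'm B by auto
    have aeA: "AE w in W. w \<in> A \<longleftrightarrow> w \<in> A1"
      using ae\<rho> by eventually_elim (simp add: AX A1_def Y'_def)
    interpret S: finite_measure_subalgebra W "past N W Ys i"
      by (intro finite_measure_subalgebra.intro finite_measure_subalgebra_axioms.intro
          subS) unfold_locales
    have intB: "integrable W (\<lambda>w. indicator B (Ys (Suc i) w) :: real)"
      by (rule integrable_const_bound[where B=1]) auto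
    have [measurable]: "(\<lambda>w. measure (P (T' i w)) B) \<in> borel_measurable W"
      by (rule measurable_compose[OF measurable_compose[OF T'm P_measurable] measurable_measure_prob_algebra[OF B]])
    have PP: "prob_space (P (T' i w))" if "w \<in> space W" for w
      by (rule prob_space_P[OF T'in[OF that]])
    have "emeasure W (A \<inter> Y' (Suc i) -` B) = emeasure W {w\<in>space W. w \<in> A \<and> Y' (Suc i) w \<in> B}"
      by (rule arg_cong[where f="emeasure W"]) (auto dest: sets.sets_into_space[OF AW, THEN subsetD])
    also have "\<dots> = emeasure W {w\<in>space W. w \<in> A1 \<and> Ys (Suc i) w \<in> B}"
      by (rule emeasure_eq_AE) (use aeA ae\<rho> in eventually_elim, auto simp: Y'_def)
    also have "\<dots> = ennreal (\<integral>w. indicator {w\<in>space W. w \<in> A1 \<and> Ys (Suc i) w \<in> B} w \<partial>W)"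
      by (simp add: emeasure_eq_measure)
    also have "(\<integral>w. indicator {w\<in>space W. w \<in> A1 \<and> Ys (Suc i) w \<in> B} w \<partial>W) =
        (\<integral>w\<in>A1. indicator B (Ys (Suc i) w) \<partial>W)"
      unfolding set_lebesgue_integral_def
      by (intro Bochner_Integration.integral_cong) (auto simp: indicator_def)
    also have "\<dots> = (\<integral>w\<in>A1. real_cond_exp W (past N W Ys i) (\<lambda>w. indicator B (Ys (Suc i) w)) w \<partial>W)"
      by (rule S.real_cond_exp_intA[OF intB A1])
    also have "\<dots> = (\<integral>w. indicator A w * measure (P (T' i w)) B \<partial>W)"
      unfolding set_lebesgue_integral_def
    proof (rule integral_cong_AE)
      show "AE w in W. indicat_real A1 w *\<^sub>R real_cond_exp W (past N W Ys i) (\<lambda>w. indicator B (Ys (Suc i) w)) w =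
          indicator A w * measure (P (T' i w)) B"
        using aeA ae\<rho> law[OF B, of i] by eventually_elim (simp add: T'_def indicator_def)
    qed measurable
    also have "ennreal \<dots> = (\<integral>\<^sup>+w. ennreal (indicator A w * measure (P (T' i w)) B) \<partial>W)"
    proof (rule nn_integral_eq_integral[symmetric])
      show "integrable W (\<lambda>w. indicator A w * measure (P (T' i w)) B)"
      proof (rule integrable_const_bound[where B=1])
        show "AE w in W. norm (indicator A w * measure (P (T' i w)) B) \<le> 1"
          using PP by (intro AE_I2) (auto simp: indicator_def prob_space.prob_le_1)
      qed measurable
    qed simp
    also have "\<dots> = (\<integral>\<^sup>+w. indicator A w * emeasure (P (T' i w)) B \<partial>W)"
    proof (rule nn_integral_cong)
      fix w assume w: "w \<in> space W"
      interpret Pw: prob_space "P (T' i w)" by (rule PP[OF w])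
      show "ennreal (indicator A w * measure (P (T' i w)) B) = indicator A w * emeasure (P (T' i w)) B"
        by (simp add: indicator_def Pw.emeasure_eq_measure)
    qed
    finally show ?thesis .
  qed
  \<comment> \<open>The index shift: simulated observations are numbered from 1, and number
    \<open>Suc i\<close> is drawn from the model at \<open>T' i\<close>.\<close>
  have "adaptive_recursion \<Theta> N P Z v W ?F (\<lambda>i. Y' (Suc i)) T' b t"
    by (unfold_locales; (fact sub adapted T'0 T'S | rule T'in Y'm past_mono cond; simp add: Y'm)?)
  moreover have "AE w in W. \<forall>i. T' i w = T i w"
    using ae\<rho> by eventually_elim (simp add: T'_def)
  ultimately show thesis by (rule that)
qed

section \<open>The rate and the limiting distribution\<close>

text \<open>The lower bound compares 1/k^2 with 1/k - 1/(k + 1) = 1/(k (k + 1)) and telescopes from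
  k = n + 1. It ensures that the largest step size, 1/(n + 1), is small relative to the
  rate.\<close>

lemma
  shows post_rate_sums: "(\<lambda>i. (inverse (real (n + Suc i)))\<^sup>2) sums (post_rate n)\<^sup>2"
    and post_rate_lower: "inverse (real (Suc n)) \<le> (post_rate n)\<^sup>2"
    and post_rate_pos: "0 < post_rate n"
proof -
  have s0: "summable (\<lambda>i. inverse ((real i)\<^sup>2))"
    using inverse_power_summable[of 2, where 'a=real] by simp
  have s: "summable (\<lambda>i. inverse ((real (n + 1 + i))\<^sup>2))"
    using summable_ignore_initial_segment[OF s0, of "n + 1"] by (simp add: add_ac)
  have pos: "0 \<le> (\<Sum>i. inverse ((real (n + 1 + i))\<^sup>2))"
    by (rule suminf_nonneg[OF s]) simp
  then show sums: "(\<lambda>i. (inverse (real (n + Suc i)))\<^sup>2) sums (post_rate n)\<^sup>2"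
    using summable_sums[OF s] by (simp add: post_rate_def power_inverse)
  have "(\<lambda>i. inverse (real (n + Suc i)) - inverse (real (n + Suc (Suc i)))) sums (inverse (real (n + Suc 0)) - 0)"
    by (rule telescope_sums'[of "\<lambda>i. inverse (real (n + Suc i))"])
       (use LIMSEQ_ignore_initial_segment[OF LIMSEQ_inverse_real_of_nat, of n] in \<open>simp add: add_ac\<close>)
  then have "inverse (real (n + Suc 0)) - 0 \<le> (post_rate n)\<^sup>2"
  proof (rule sums_le[OF _ _ sums, rotated])
    fix i
    show "inverse (real (n + Suc i)) - inverse (real (n + Suc (Suc i))) \<le> (inverse (real (n + Suc i)))\<^sup>2"
      by (simp add: divide_simps power2_eq_square)
  qed
  then show le: "inverse (real (Suc n)) \<le> (post_rate n)\<^sup>2" by simp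
  have "0 < inverse (real (Suc n))" by simp
  then have "0 < (post_rate n)\<^sup>2" using le by (rule less_le_trans)
  moreover have "0 \<le> post_rate n" using pos by (simp add: post_rate_def)
  ultimately show "0 < post_rate n" by (simp add: zero_less_power2)
qed

lemma post_rate_tendsto: "(\<lambda>n. (post_rate n)\<^sup>2) \<longlonglongrightarrow> 0"
proof -
  let ?f = "\<lambda>i. (inverse (real (Suc i)))\<^sup>2"
  have s: "summable ?f" using post_rate_sums[of 0] by (simp add: sums_iff)
  have "(\<lambda>n. suminf ?f - (\<Sum>i<n. ?f i)) \<longlonglongrightarrow> suminf ?f - suminf ?f"
    by (intro tendsto_diff tendsto_const summable_LIMSEQ[OF s])
  moreover have "(post_rate n)\<^sup>2 = suminf ?f - (\<Sum>i<n. ?f i)" for n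
  proof -
    have "(post_rate n)\<^sup>2 = (\<Sum>i. ?f (i + n))"
      using post_rate_sums[of n] by (simp add: sums_iff add_ac)
    then show ?thesis using suminf_minus_initial_segment[OF s, of n] by simp
  qed
  ultimately show ?thesis by simp
qed

section \<open>The normal limit as a scaled standard normal law\<close>

lemma normal_dist_eq_distr:
  assumes "0 < \<sigma>"
  shows "normal_dist 0 \<sigma> = distr std_normal_distribution borel (\<lambda>x. sqrt \<sigma> * x)"
proof -
  interpret prob_space std_normal_distribution
    by (rule prob_space_normal_density) simp
  have "distributed std_normal_distribution lborel (\<lambda>x. x) (normal_density 0 1)"
    unfolding distributed_def by (auto intro!: distr_id2)
  from normal_density_affine[OF this, of "sqrt \<sigma>" 0] assms
  have "distributed std_normal_distribution lborel (\<lambda>x. sqrt \<sigma> * x) (normal_density 0 (sqrt \<sigma>))"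
    by simp
  then have "density lborel (normal_density 0 (sqrt \<sigma>)) = distr std_normal_distribution lborel (\<lambda>x. sqrt \<sigma> * x)"
    by (simp add: distributed_def)
  also have "\<dots> = distr std_normal_distribution borel (\<lambda>x. sqrt \<sigma> * x)"
    by (rule distr_cong) auto
  finally show ?thesis by (simp add: normal_dist_def)
qed

lemma real_distribution_normal_dist: "0 < \<sigma> \<Longrightarrow> real_distribution (normal_dist 0 \<sigma>)"
  unfolding normal_dist_eq_distr
  by (rule prob_space.real_distribution_distr[OF prob_space_normal_density]) auto

lemma char_normal_dist:
  assumes "0 < \<sigma>"
  shows "char (normal_dist 0 \<sigma>) u = of_real (exp (- (u\<^sup>2 * \<sigma> / 2)))"
proof -
  have "char (normal_dist 0 \<sigma>) u = char std_normal_distribution (u * sqrt \<sigma>)"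
    unfolding normal_dist_eq_distr[OF assms] char_def
    by (subst integral_distr) (auto simp: mult_ac)
  then show ?thesis
    using assms by (simp add: char_std_normal_distribution power_mult_distrib)
qed

section \<open>Weak convergence of the martingale posterior\<close>

text \<open>A bound for fixed n, obtained by running \<open>char_limit\<close> at the argument u /
  r, with r = \<open>post_rate n\<close>, on an everywhere valid version of the scheme.\<close>

lemma posterior_char_bound:
  assumes fam: "quartic_family \<Theta> \<mu> (model \<mu> p) (scaled_score \<mu> p s) v B C"
    and scheme: "posterior_scheme \<mu> \<Theta> p s n t W Ys T"
    and A: "0 \<le> A" and growth: "\<And>\<theta>. \<theta> \<in> \<Theta> \<Longrightarrow> v \<theta> \<le> A * (1 + (\<theta> - a)\<^sup>2)"
    and \<sigma>: "0 \<le> \<sigma>" and \<epsilon>: "0 \<le> \<epsilon>" and K: "0 \<le> K"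
    and step: "\<And>\<theta> c. \<theta> \<in> \<Theta> \<Longrightarrow> \<bar>c\<bar> \<le> h \<Longrightarrow>
      cmod ((\<integral>y. iexp (c * scaled_score \<mu> p s \<theta> y) \<partial>model \<mu> p \<theta>) - exp (- (c\<^sup>2 * \<sigma> / 2))) \<le> c\<^sup>2 * (\<epsilon> + K * (\<theta> - a)\<^sup>2)"
    and n: "\<bar>u\<bar> * post_rate n \<le> h"
  shows "cmod (char (distr W borel (\<lambda>w. (posterior_limit T w - t) / post_rate n)) u - exp (- (u\<^sup>2 * \<sigma> / 2)))
    \<le> u\<^sup>2 * (\<epsilon> + K * ((1 + (t - a)\<^sup>2) * exp (A * (post_rate n)\<^sup>2) - 1))"
proof -
  interpret quartic_family \<Theta> \<mu> "model \<mu> p" "scaled_score \<mu> p s" v B C by (rule fam)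
  let ?b = "\<lambda>i. inverse (real (n + Suc i))" and ?r = "post_rate n"
  have W: "prob_space W" and T: "\<And>i. T i \<in> borel_measurable W"
    using scheme by (auto simp: posterior_scheme_def)
  obtain F Y T' where rec: "adaptive_recursion \<Theta> \<mu> (model \<mu> p) (scaled_score \<mu> p s) v W F Y T' ?b t"
    and ae: "AE w in W. \<forall>i. T' i w = T i w"
    by (rule adaptive_recursion_of_AE[of W Ys T t ?b])
       (use scheme[unfolded posterior_scheme_def] in auto)
  interpret R: adaptive_recursion \<Theta> \<mu> "model \<mu> p" "scaled_score \<mu> p s" v W F Y T' ?b t
    by (rule rec)
  have S: "(\<Sum>j<i. (?b j)\<^sup>2) \<le> ?r\<^sup>2" for i
    using post_rate_sums[of n] sum_le_suminf[of "\<lambda>j. (?b j)\<^sup>2" "{..<i}"] by (auto simp: sums_iff)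
  have conv: "AE w in W. convergent (\<lambda>i. T' i w)"
    by (rule R.AE_convergent_T[OF A growth S]) (auto simp: divide_simps)
  have r: "0 < ?r" by (rule post_rate_pos)
  \<comment> \<open>Each step size is at most 1/(n + 1) \<le> r^2, so every argument of the one-step
    approximation is at most |u| r, hence at most \<open>h\<close>.\<close>
  have small: "\<bar>u / ?r * ?b i\<bar> \<le> h" for i
  proof -
    have "?b i \<le> inverse (real (Suc n))" by (simp add: divide_simps)
    also have "\<dots> \<le> ?r\<^sup>2" by (rule post_rate_lower)
    finally have "\<bar>u\<bar> / ?r * ?b i \<le> \<bar>u\<bar> / ?r * ?r\<^sup>2"
      using r by (intro mult_left_mono) auto
    also have "\<dots> = \<bar>u\<bar> * ?r" using r by (simp add: power2_eq_square)
    finally show ?thesis using n r by (simp add: abs_mult)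
  qed
  \<comment> \<open>Dividing the argument by r normalises the sum of the squared one-step arguments
    to u^2, whatever n is.\<close>
  have "cmod ((\<integral>w. iexp (u / ?r * (lim (\<lambda>i. T' i w) - t)) \<partial>W) - exp (- ((u / ?r)\<^sup>2 * ?r\<^sup>2 * \<sigma> / 2)))
    \<le> (u / ?r)\<^sup>2 * ?r\<^sup>2 * (\<epsilon> + K * ((1 + (t - a)\<^sup>2) * exp (A * ?r\<^sup>2) - 1))"
    by (rule R.char_limit[OF \<sigma> \<epsilon> K step[OF _ small] R.square_integrable_T[OF A growth S]
          R.second_moment_le[OF A growth S] conv post_rate_sums])
  moreover have "(u / ?r)\<^sup>2 * ?r\<^sup>2 = u\<^sup>2" using r by (simp add: power_divide)
  moreover have "(\<integral>w. iexp (u / ?r * (lim (\<lambda>i. T' i w) - t)) \<partial>W) =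
      char (distr W borel (\<lambda>w. (posterior_limit T w - t) / ?r)) u"
  proof -
    have [measurable]: "posterior_limit T \<in> borel_measurable W"
      unfolding posterior_limit_def[abs_def] using T by (rule borel_measurable_lim_metric)
    have "char (distr W borel (\<lambda>w. (posterior_limit T w - t) / ?r)) u =
      (\<integral>w. iexp (u * ((posterior_limit T w - t) / ?r)) \<partial>W)"
      unfolding char_def by (subst integral_distr) auto
    also have "\<dots> = (\<integral>w. iexp (u / ?r * (lim (\<lambda>i. T' i w) - t)) \<partial>W)"
    proof (rule integral_cong_AE)
      show "AE w in W. iexp (u * ((posterior_limit T w - t) / ?r)) = iexp (u / ?r * (lim (\<lambda>i. T' i w) - t))"
        using ae by eventually_elim (simp add: posterior_limit_def)
    qed measurable
    finally show ?thesis by simp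
  qed
  ultimately show ?thesis by simp
qed

text \<open>The data are fixed and enter only through a deterministic sequence of starting points.
  For given u the constants K and h are chosen first, and n is taken large afterwards.\<close>

lemma posterior_weak_limit:
  assumes fam: "quartic_family \<Theta> \<mu> (model \<mu> p) (scaled_score \<mu> p s) v B C"
    and a: "a \<in> \<Theta>" and cont: "continuous (at a within \<Theta>) v" and pos: "0 < v a"
    and scheme: "\<And>n. n \<ge> 1 \<Longrightarrow> posterior_scheme \<mu> \<Theta> p s n (t n) (W n) (Ys n) (T n)"
    and t: "t \<longlonglongrightarrow> a"
  shows "weak_conv_m (\<lambda>n. distr (W n) borel (\<lambda>w. (posterior_limit (T n) w - t n) / post_rate n))
    (normal_dist 0 (v a))"
proof -
  interpret quartic_family \<Theta> \<mu> "model \<mu> p" "scaled_score \<mu> p s" v B C by (rule fam)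
  define A where "A = 1 + B + (1 + C) * (2 * a\<^sup>2 + 2)"
  have A: "0 \<le> A" using B_nonneg C_nonneg by (simp add: A_def)
  have growth: "v \<theta> \<le> A * (1 + (\<theta> - a)\<^sup>2)" if "\<theta> \<in> \<Theta>" for \<theta>
    unfolding A_def by (rule variance_growth[OF that])
  let ?L = "\<lambda>n. distr (W n) borel (\<lambda>w. (posterior_limit (T n) w - t n) / post_rate n)"
  have char: "(\<lambda>n. char (?L n) u) \<longlonglongrightarrow> char (normal_dist 0 (v a)) u" for u
    unfolding char_normal_dist[OF pos]
  proof (rule tendstoI)
    fix e :: real assume e: "0 < e"
    \<comment> \<open>This makes 2 \<epsilon> u^2 < e; the summand 1 covers u = 0.\<close>
    define \<epsilon> where "\<epsilon> = e / (2 * u\<^sup>2 + 1)"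
    have den: "0 < 2 * u\<^sup>2 + 1" by (simp add: add_nonneg_pos)
    have \<epsilon>: "0 < \<epsilon>" using e den by (simp add: \<epsilon>_def)
    have e2: "u\<^sup>2 * (2 * \<epsilon>) < e"
      using e den by (simp add: \<epsilon>_def divide_simps)
    obtain K h where K: "0 \<le> K" and h: "0 < h" and step: "\<And>\<theta> c. \<theta> \<in> \<Theta> \<Longrightarrow> \<bar>c\<bar> \<le> h \<Longrightarrow>
      cmod ((\<integral>y. iexp (c * scaled_score \<mu> p s \<theta> y) \<partial>model \<mu> p \<theta>) - exp (- (c\<^sup>2 * v a / 2))) \<le> c\<^sup>2 * (\<epsilon> + K * (\<theta> - a)\<^sup>2)"
      using char_gaussian_approx[OF a cont \<epsilon>] by blast
    let ?X = "\<lambda>n. (1 + (t n - a)\<^sup>2) * exp (A * (post_rate n)\<^sup>2) - 1"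
    have "(\<lambda>n. sqrt ((post_rate n)\<^sup>2)) \<longlonglongrightarrow> sqrt 0"
      by (intro tendsto_intros post_rate_tendsto)
    then have "post_rate \<longlonglongrightarrow> 0"
      using post_rate_pos by (simp add: less_imp_le)
    then have "(\<lambda>n. \<bar>u\<bar> * post_rate n) \<longlonglongrightarrow> \<bar>u\<bar> * 0" by (intro tendsto_intros)
    then have ev1: "\<forall>\<^sub>F n in sequentially. \<bar>u\<bar> * post_rate n < h"
      by (rule order_tendstoD(2)) (simp add: h)
    \<comment> \<open>The limit is 0 since the starting points tend to \<open>a\<close> and the rate
      tends to 0 while \<open>K\<close> stays fixed.\<close>
    have "(\<lambda>n. K * ?X n) \<longlonglongrightarrow> K * ((1 + (a - a)\<^sup>2) * exp (A * 0) - 1)"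
      by (intro tendsto_intros t post_rate_tendsto)
    then have ev2: "\<forall>\<^sub>F n in sequentially. K * ?X n < \<epsilon>"
      by (rule order_tendstoD(2)) (simp add: \<epsilon>)
    show "\<forall>\<^sub>F n in sequentially. dist (char (?L n) u) (of_real (exp (- (u\<^sup>2 * v a / 2)))) < e"
      using ev1 ev2 eventually_ge_at_top[of 1]
    proof eventually_elim
      case (elim n)
      have "dist (char (?L n) u) (of_real (exp (- (u\<^sup>2 * v a / 2)))) \<le> u\<^sup>2 * (\<epsilon> + K * ?X n)"
        unfolding dist_norm
        by (rule posterior_char_bound[OF fam scheme A growth _ _ K step])
           (use elim pos \<epsilon> in auto)
      also have "\<dots> \<le> u\<^sup>2 * (2 * \<epsilon>)" using elim(2) by (intro mult_left_mono) auto
      also note e2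
      finally show ?case .
    qed
  qed
  have dist: "real_distribution (?L n)" if "n \<ge> 1" for n
  proof -
    have "prob_space (W n)" and T: "\<And>i. T n i \<in> borel_measurable (W n)"
      using scheme[OF that] by (auto simp: posterior_scheme_def)
    have [measurable]: "posterior_limit (T n) \<in> borel_measurable (W n)"
      unfolding posterior_limit_def[abs_def] using T by (rule borel_measurable_lim_metric)
    show ?thesis
      by (rule prob_space.real_distribution_distr[OF \<open>prob_space (W n)\<close>]) measurable
  qed
  \<comment> \<open>The schemes are given for n \<ge> 1 only, so Levy's theorem is applied to the
    shifted sequence; the first term does not affect the limit.\<close>
  have "weak_conv_m (\<lambda>n. ?L (Suc n)) (normal_dist 0 (v a))"
    by (rule levy_continuity[OF dist real_distribution_normal_dist[OF pos] LIMSEQ_Suc[OF char]]) simp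
  then show ?thesis
    unfolding weak_conv_m_def weak_conv_def by (auto intro: LIMSEQ_imp_Suc)
qed

text \<open>The variance of the scaled score is I^-2 * I = 1/I, and continuity of the information on
  \<open>\<Theta>\<close> supplies its measurability there.\<close>

lemma quartic_family_scaled_score:
  assumes model_measurable: "model \<mu> p \<in> restrict_space borel \<Theta> \<rightarrow>\<^sub>M prob_algebra \<mu>"
    and s_measurable: "(\<lambda>(\<theta>, y). s \<theta> y) \<in> borel_measurable (restrict_space borel \<Theta> \<Otimes>\<^sub>M \<mu>)"
    and score_integrable: "\<And>\<theta>. \<theta> \<in> \<Theta> \<Longrightarrow> integrable (model \<mu> p \<theta>) (s \<theta>)"
    and score_mean: "\<And>\<theta>. \<theta> \<in> \<Theta> \<Longrightarrow> (\<integral>y. s \<theta> y \<partial>model \<mu> p \<theta>) = 0"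
    and info_finite: "\<And>\<theta>. \<theta> \<in> \<Theta> \<Longrightarrow> integrable (model \<mu> p \<theta>) (\<lambda>y. (s \<theta> y)\<^sup>2)"
    and info_continuous: "\<And>\<theta>. \<theta> \<in> \<Theta> \<Longrightarrow> continuous (at \<theta> within \<Theta>) (fisher_info \<mu> p s)"
    and info_pos: "\<And>\<theta>. \<theta> \<in> \<Theta> \<Longrightarrow> fisher_info \<mu> p s \<theta> > 0"
    and BC_nonneg: "B \<ge> 0" "C \<ge> 0"
    and fourth_moment_finite:
      "\<And>\<theta>. \<theta> \<in> \<Theta> \<Longrightarrow> integrable (model \<mu> p \<theta>) (\<lambda>y. (scaled_score \<mu> p s \<theta> y) ^ 4)"
    and fourth_moment_bound:
      "\<And>\<theta>. \<theta> \<in> \<Theta> \<Longrightarrow> (\<integral>y. (scaled_score \<mu> p s \<theta> y) ^ 4 \<partial>model \<mu> p \<theta>) \<le> B + C * \<theta> ^ 4"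
  shows "quartic_family \<Theta> \<mu> (model \<mu> p) (scaled_score \<mu> p s) (\<lambda>\<theta>. inverse (fisher_info \<mu> p s \<theta>)) B C"
proof
  have I: "fisher_info \<mu> p s \<in> borel_measurable (restrict_space borel \<Theta>)"
    by (rule borel_measurable_continuous_on_restrict)
       (simp add: continuous_on_eq_continuous_within info_continuous)
  have [measurable]: "(\<lambda>x. fisher_info \<mu> p s (fst x)) \<in> borel_measurable (restrict_space borel \<Theta> \<Otimes>\<^sub>M \<mu>)"
    by (rule measurable_compose[OF measurable_fst I])
  have [measurable]: "(\<lambda>x. s (fst x) (snd x)) \<in> borel_measurable (restrict_space borel \<Theta> \<Otimes>\<^sub>M \<mu>)"
    using s_measurable by (simp add: case_prod_beta')
  show "(\<lambda>(\<theta>, y). scaled_score \<mu> p s \<theta> y) \<in> borel_measurable (restrict_space borel \<Theta> \<Otimes>\<^sub>M \<mu>)"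
    unfolding case_prod_beta' scaled_score_def by measurable
  show "(\<integral>y. (scaled_score \<mu> p s \<theta> y)\<^sup>2 \<partial>model \<mu> p \<theta>) = inverse (fisher_info \<mu> p s \<theta>)"
    if "\<theta> \<in> \<Theta>" for \<theta>
  proof -
    have "(\<integral>y. (scaled_score \<mu> p s \<theta> y)\<^sup>2 \<partial>model \<mu> p \<theta>) = (inverse (fisher_info \<mu> p s \<theta>))\<^sup>2 * fisher_info \<mu> p s \<theta>"
      unfolding scaled_score_def power_mult_distrib by (simp add: fisher_info_def)
    also have "\<dots> = inverse (fisher_info \<mu> p s \<theta>)"
      using info_pos[OF that] by (simp add: power2_eq_square)
    finally show ?thesis .
  qed
  have eq: "scaled_score \<mu> p s \<theta> = (\<lambda>y. inverse (fisher_info \<mu> p s \<theta>) * s \<theta> y)" for \<theta>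
    by (simp add: fun_eq_iff scaled_score_def)
  show "integrable (model \<mu> p \<theta>) (scaled_score \<mu> p s \<theta>)" "(\<integral>y. scaled_score \<mu> p s \<theta> y \<partial>model \<mu> p \<theta>) = 0"
    "integrable (model \<mu> p \<theta>) (\<lambda>y. (scaled_score \<mu> p s \<theta> y)\<^sup>2)" if "\<theta> \<in> \<Theta>" for \<theta>
    using that by (simp_all add: eq power_mult_distrib score_integrable score_mean info_finite)
qed (fact assms)+

theorem theorem3:
  fixes \<mu> :: "'y measure"
    and \<Theta> :: "real set"
    and p s :: "real \<Rightarrow> 'y \<Rightarrow> real"
    and \<theta>star B C :: real
    and M :: "'o measure"
    and Y :: "nat \<Rightarrow> 'o \<Rightarrow> 'y"
    and est :: "nat \<Rightarrow> (nat \<Rightarrow> 'y) \<Rightarrow> real"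
    and W :: "nat \<Rightarrow> (nat \<Rightarrow> 'y) \<Rightarrow> 'w measure"
    and Ys :: "nat \<Rightarrow> (nat \<Rightarrow> 'y) \<Rightarrow> nat \<Rightarrow> 'w \<Rightarrow> 'y"
    and T :: "nat \<Rightarrow> (nat \<Rightarrow> 'y) \<Rightarrow> nat \<Rightarrow> 'w \<Rightarrow> real"
  defines "data \<equiv> (\<lambda>n \<omega>. \<lambda>i\<in>{1..n}. Y i \<omega>)"
  assumes p_measurable: "\<And>\<theta>. \<theta> \<in> \<Theta> \<Longrightarrow> p \<theta> \<in> borel_measurable \<mu>"
    and p_nonneg: "\<And>\<theta> y. \<theta> \<in> \<Theta> \<Longrightarrow> y \<in> space \<mu> \<Longrightarrow> p \<theta> y \<ge> 0"
    and p_density: "\<And>\<theta>. \<theta> \<in> \<Theta> \<Longrightarrow> prob_space (model \<mu> p \<theta>)"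
    and model_measurable: "model \<mu> p \<in> restrict_space borel \<Theta> \<rightarrow>\<^sub>M prob_algebra \<mu>"
    and s_measurable: "(\<lambda>(\<theta>, y). s \<theta> y) \<in> borel_measurable (restrict_space borel \<Theta> \<Otimes>\<^sub>M \<mu>)"
    and score: "\<And>\<theta>. \<theta> \<in> \<Theta> \<Longrightarrow> AE y in model \<mu> p \<theta>. has_score \<Theta> p \<theta> y (s \<theta> y)"
    and score_integrable: "\<And>\<theta>. \<theta> \<in> \<Theta> \<Longrightarrow> integrable (model \<mu> p \<theta>) (s \<theta>)"
    and score_mean: "\<And>\<theta>. \<theta> \<in> \<Theta> \<Longrightarrow> (\<integral>y. s \<theta> y \<partial>model \<mu> p \<theta>) = 0"
    and info_finite: "\<And>\<theta>. \<theta> \<in> \<Theta> \<Longrightarrow> integrable (model \<mu> p \<theta>) (\<lambda>y. (s \<theta> y)\<^sup>2)"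
    and info_continuous:
      "\<And>\<theta>. \<theta> \<in> \<Theta> \<Longrightarrow> continuous (at \<theta> within \<Theta>) (fisher_info \<mu> p s)"
    and info_pos: "\<And>\<theta>. \<theta> \<in> \<Theta> \<Longrightarrow> fisher_info \<mu> p s \<theta> > 0"
    and \<theta>star: "\<theta>star \<in> \<Theta>"
    and M_prob: "prob_space M"
    and Y_indep: "prob_space.indep_vars M (\<lambda>_. \<mu>) Y {1..}"
    and Y_distr: "\<And>i. i \<ge> 1 \<Longrightarrow> distr M \<mu> (Y i) = model \<mu> p \<theta>star"
    and inverse_info_C1: "C1_near \<Theta> (\<lambda>\<theta>. inverse (fisher_info \<mu> p s \<theta>)) \<theta>star"
    and BC_nonneg: "B \<ge> 0" "C \<ge> 0"
    and fourth_moment_finite: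
      "\<And>\<theta>. \<theta> \<in> \<Theta> \<Longrightarrow> integrable (model \<mu> p \<theta>) (\<lambda>y. (scaled_score \<mu> p s \<theta> y) ^ 4)"
    and fourth_moment_bound:
      "\<And>\<theta>. \<theta> \<in> \<Theta> \<Longrightarrow> (\<integral>y. (scaled_score \<mu> p s \<theta> y) ^ 4 \<partial>model \<mu> p \<theta>) \<le> B + C * \<theta> ^ 4"
    and est_measurable:
      "\<And>n. n \<ge> 1 \<Longrightarrow> est n \<in> borel_measurable (Pi\<^sub>M {1..n} (\<lambda>_. \<mu>))"
    and est_in: "\<And>n x. n \<ge> 1 \<Longrightarrow> x \<in> space (Pi\<^sub>M {1..n} (\<lambda>_. \<mu>)) \<Longrightarrow> est n x \<in> \<Theta>"
    and est_consistent: "AE \<omega> in M. (\<lambda>n. est n (data n \<omega>)) \<longlonglongrightarrow> \<theta>star"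
    and scheme: "\<And>n. n \<ge> 1 \<Longrightarrow> AE \<omega> in M.
      posterior_scheme \<mu> \<Theta> p s n (est n (data n \<omega>))
        (W n (data n \<omega>)) (Ys n (data n \<omega>)) (T n (data n \<omega>))"
  shows "AE \<omega> in M. weak_conv_m
    (\<lambda>n. distr (W n (data n \<omega>)) borel
      (\<lambda>w. (posterior_limit (T n (data n \<omega>)) w - est n (data n \<omega>)) / post_rate n))
    (normal_dist 0 (inverse (fisher_info \<mu> p s \<theta>star)))"
proof -
  have fam: "quartic_family \<Theta> \<mu> (model \<mu> p) (scaled_score \<mu> p s) (\<lambda>\<theta>. inverse (fisher_info \<mu> p s \<theta>)) B C"
    by (rule quartic_family_scaled_score) (fact assms)+
  have cont: "continuous (at \<theta>star within \<Theta>) (\<lambda>\<theta>. inverse (fisher_info \<mu> p s \<theta>))"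
    using info_continuous[OF \<theta>star] info_pos[OF \<theta>star] by (intro continuous_at_within_inverse) auto
  \<comment> \<open>Countably many n share one null set; outside it and the exceptional set of
    consistency the claim is the deterministic \<open>posterior_weak_limit\<close>.\<close>
  have "AE \<omega> in M. \<forall>n. n \<ge> 1 \<longrightarrow> posterior_scheme \<mu> \<Theta> p s n (est n (data n \<omega>))
        (W n (data n \<omega>)) (Ys n (data n \<omega>)) (T n (data n \<omega>))"
    unfolding AE_all_countable using scheme by (auto intro: AE_I2)
  with est_consistent show ?thesis
  proof eventually_elim
    case (elim \<omega>)
    show ?case
      by (rule posterior_weak_limit[OF fam \<theta>star cont _ _ elim(1), where W="\<lambda>n. W n (data n \<omega>)"
            and T="\<lambda>n. T n (data n \<omega>)" and Ys="\<lambda>n. Ys n (data n \<omega>)"])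
         (use elim(2) info_pos[OF \<theta>star] in auto)
  qed
qed

end
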